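(* Let $T\in\mathcal{B}_A(\mathcal{H})$, $\alpha\in[0,1]$, $r\geq 1$ and $\beta\geq 0$. Then $$w_A^{4r}(T)\leq \frac{\delta_1}{4}\left\|\left(T^{\sharp_A} T\right)^{r}+\left(TT^{\sharp_A}\right)^{r}\right\|_A^2+\delta_2\, w_A^{2r}(T^2),$$ where $$\delta_1=\frac{1+\alpha+2\beta}{2(1+\beta)}\quad\text{and}\quad \delta_2=\frac{1-\alpha}{2(1+\beta)}.$$
   Context: $(\mathcal{H},\langle\cdot,\cdot\rangle)$ is a nontrivial complex Hilbert space, $\mathcal{B}(\mathcal{H})$ is the algebra of bounded linear operators on $\mathcal{H}$, and $A\in\mathcal{B}(\mathcal{H})$ is a positive operator, i.e. $\langle Ax,x\rangle\ge 0$ for all $x\in\mathcal{H}$. The semi-inner product induced by $A$ is $\langle x,y\rangle_A=\langle Ax,y\rangle$, with seminorm $\|x\|_A=\sqrt{\langle x,x\rangle_A}$ on $\mathcal{H}$. $\mathcal{B}_A(\mathcal{H})=\{T\in\mathcal{B}(\mathcal{H}): \operatorname{ran}(T^*A)\subseteq\operatorname{ran}(A)\}$ is the set of operators admitting an $A$-adjoint. For $T\in\mathcal{B}_A(\mathcal{H})$, $T^{\sharp_A}=A^{\dagger}T^*A$ (with $A^\dagger$ the Moore-Penrose inverse of $A$) is the unique bounded solution $X$ of $AX=T^*A$ whose range is contained in $\overline{\operatorname{ran}(A)}$; it satisfies $\langle Tx,y\rangle_A=\langle x,T^{\sharp_A}y\rangle_A$ for all $x,y\in\mathcal{H}$. For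 $T\in\mathcal{B}_A(\mathcal{H})$, the $A$-operator seminorm is $\|T\|_A=\sup\{\|Tx\|_A: x\in\mathcal{H},\ \|x\|_A=1\}$ and the $A$-numerical radius is $w_A(T)=\sup\{|\langle Tx,x\rangle_A|: x\in\mathcal{H},\ \|x\|_A=1\}$; $w_A^s(T)$ means $(w_A(T))^s$. Convention on powers: an operator $P$ is $A$-positive if $AP$ is positive; $T^{\sharp_A}T$ and $TT^{\sharp_A}$ are $A$-positive. For integer exponents, powers are ordinary operator powers. For non-integer $s\ge 1$, powers of $A$-positive operators $P\in\mathcal{B}_A(\mathcal{H})$ are understood on the Hilbert space $\mathcal{H}_A$ obtained by completing $\mathcal{H}/\ker A$ with respect to $\langle\cdot,\cdot\rangle_A$: $P$ induces a bounded positive operator $\widetilde P$ on $\mathcal{H}_A$, $P^s$ stands for $\widetilde P^{\,s}$ (continuous functional calculus), and the $A$-seminorm of a sum of such powers is the operator norm on $\mathcal{H}_A$ (for integer $s$ this agrees with the seminorm above). *)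

theory Defs
  imports "HOL-Analysis.Analysis" "HOL-Computational_Algebra.Polynomial"
begin

section \<open>Complex Hilbert spaces\<close>

text \<open>The complex inner product is linear in its first argument.  Positive definiteness, the norm
  and the topology are inherited from the underlying real inner product
  \<open>x \<bullet> y = Re (cinner x y)\<close>.\<close>

class complex_inner = real_inner +
  fixes scaleC :: "complex \<Rightarrow> 'a \<Rightarrow> 'a" (infixr "*\<^sub>C" 75)
    and cinner :: "'a \<Rightarrow> 'a \<Rightarrow> complex"
  assumes scaleC_add_right: "c *\<^sub>C (x + y) = c *\<^sub>C x + c *\<^sub>C y"
    and scaleC_add_left: "(c + d) *\<^sub>C x = c *\<^sub>C x + d *\<^sub>C x"
    and scaleC_scaleC: "c *\<^sub>C d *\<^sub>C x = (c * d) *\<^sub>C x"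
    and scaleR_scaleC: "a *\<^sub>R x = complex_of_real a *\<^sub>C x"
    and cinner_commute: "cinner x y = cnj (cinner y x)"
    and cinner_add_left: "cinner (x + y) z = cinner x z + cinner y z"
    and cinner_scaleC_left: "cinner (c *\<^sub>C x) y = c * cinner x y"
    and inner_cinner: "x \<bullet> y = Re (cinner x y)"

class chilbert_space = complex_inner + complete_space

instantiation complex :: chilbert_space
begin

definition scaleC_complex :: "complex \<Rightarrow> complex \<Rightarrow> complex" where
  "scaleC_complex c x = c * x"

definition cinner_complex :: "complex \<Rightarrow> complex \<Rightarrow> complex" where
  "cinner_complex x y = x * cnj y"

instance
  by standard (auto simp: scaleC_complex_def cinner_complex_def inner_complex_def
      algebra_simps scaleR_conv_of_real)

end

definition bounded_clinear :: "('a::complex_inner \<Rightarrow> 'a) \<Rightarrow> bool" where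
  "bounded_clinear T \<longleftrightarrow> bounded_linear T \<and> (\<forall>c x. T (c *\<^sub>C x) = c *\<^sub>C T x)"

definition positive_op :: "('a::complex_inner \<Rightarrow> 'a) \<Rightarrow> bool" where
  "positive_op A \<longleftrightarrow> bounded_clinear A \<and> (\<forall>x. cinner (A x) x \<in> \<real>\<^sub>\<ge>\<^sub>0)"

definition cadjoint :: "('a::chilbert_space \<Rightarrow> 'a) \<Rightarrow> 'a \<Rightarrow> 'a" where
  "cadjoint T = (THE S. bounded_clinear S \<and> (\<forall>x y. cinner (T x) y = cinner x (S y)))"

definition ortho_compl :: "'a::complex_inner set \<Rightarrow> 'a set" where
  "ortho_compl M = {x. \<forall>y\<in>M. cinner x y = 0}"

text \<open>On its domain \<open>ran A + (ran A)\<^sup>\<bottom>\<close>, the Moore-Penrose inverse sends \<open>y\<close> to the unique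
  \<open>x \<in> (ker A)\<^sup>\<bottom>\<close> such that \<open>A x\<close> is the component of \<open>y\<close> in \<open>ran A\<close>; outside this domain the
  value is unspecified.\<close>

definition mp_inverse :: "('a::chilbert_space \<Rightarrow> 'a) \<Rightarrow> 'a \<Rightarrow> 'a" where
  "mp_inverse A y =
     (THE x. x \<in> ortho_compl {z. A z = 0} \<and> y - A x \<in> ortho_compl (range A))"


section \<open>The semi-inner product induced by a positive operator\<close>

definition cinnerA :: "('a::complex_inner \<Rightarrow> 'a) \<Rightarrow> 'a \<Rightarrow> 'a \<Rightarrow> complex" where
  "cinnerA A x y = cinner (A x) y"

definition normA :: "('a::complex_inner \<Rightarrow> 'a) \<Rightarrow> 'a \<Rightarrow> real" where
  "normA A x = sqrt (Re (cinnerA A x x))"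

definition BA :: "('a::chilbert_space \<Rightarrow> 'a) \<Rightarrow> ('a \<Rightarrow> 'a) set" where
  "BA A = {T. bounded_clinear T \<and> range (cadjoint T \<circ> A) \<subseteq> range A}"

definition sharpA :: "('a::chilbert_space \<Rightarrow> 'a) \<Rightarrow> ('a \<Rightarrow> 'a) \<Rightarrow> 'a \<Rightarrow> 'a" where
  "sharpA A T = mp_inverse A \<circ> cadjoint T \<circ> A"

text \<open>The suprema are taken in \<open>[0, \<infinity>)\<close>: inserting \<open>0\<close> only matters when no \<open>x\<close> has
  \<open>A\<close>-seminorm \<open>1\<close>, that is, when \<open>A = 0\<close>.\<close>

definition onormA :: "('a::chilbert_space \<Rightarrow> 'a) \<Rightarrow> ('a \<Rightarrow> 'a) \<Rightarrow> real" where
  "onormA A T = Sup (insert 0 {normA A (T x) | x. normA A x = 1})"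

definition num_radiusA :: "('a::chilbert_space \<Rightarrow> 'a) \<Rightarrow> ('a \<Rightarrow> 'a) \<Rightarrow> real" where
  "num_radiusA A T = Sup (insert 0 {cmod (cinnerA A (T x) x) | x. normA A x = 1})"


section \<open>Continuous functional calculus on a Hilbert space with explicit carrier\<close>

text \<open>The completion below depends on the operator \<open>A\<close>, so it is a structure on a carrier set and
  not a type of class \<open>chilbert_space\<close>.\<close>

record 'k cspace =
  pts :: "'k set"
  add :: "'k \<Rightarrow> 'k \<Rightarrow> 'k"
  scale :: "complex \<Rightarrow> 'k \<Rightarrow> 'k"
  ip :: "'k \<Rightarrow> 'k \<Rightarrow> complex"

definition nrm :: "'k cspace \<Rightarrow> 'k \<Rightarrow> real" where
  "nrm K x = sqrt (Re (ip K x x))"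

definition bounded_ops :: "'k cspace \<Rightarrow> ('k \<Rightarrow> 'k) set" where
  "bounded_ops K = {F. F \<in> pts K \<rightarrow> pts K
     \<and> (\<forall>x\<in>pts K. \<forall>y\<in>pts K. F (add K x y) = add K (F x) (F y))
     \<and> (\<forall>c. \<forall>x\<in>pts K. F (scale K c x) = scale K c (F x))
     \<and> (\<exists>b. \<forall>x\<in>pts K. nrm K (F x) \<le> b * nrm K x)}"

definition op_add :: "'k cspace \<Rightarrow> ('k \<Rightarrow> 'k) \<Rightarrow> ('k \<Rightarrow> 'k) \<Rightarrow> 'k \<Rightarrow> 'k" where
  "op_add K F G x = add K (F x) (G x)"

definition op_scale :: "'k cspace \<Rightarrow> complex \<Rightarrow> ('k \<Rightarrow> 'k) \<Rightarrow> 'k \<Rightarrow> 'k" where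
  "op_scale K c F x = scale K c (F x)"

definition op_diff :: "'k cspace \<Rightarrow> ('k \<Rightarrow> 'k) \<Rightarrow> ('k \<Rightarrow> 'k) \<Rightarrow> 'k \<Rightarrow> 'k" where
  "op_diff K F G = op_add K F (op_scale K (-1) G)"

definition op_norm :: "'k cspace \<Rightarrow> ('k \<Rightarrow> 'k) \<Rightarrow> real" where
  "op_norm K F = Sup (insert 0 {nrm K (F x) | x. x \<in> pts K \<and> nrm K x = 1})"

definition spectrum :: "'k cspace \<Rightarrow> ('k \<Rightarrow> 'k) \<Rightarrow> complex set" where
  "spectrum K S = {z. \<not> (\<exists>R\<in>bounded_ops K. \<forall>x\<in>pts K.
     R (op_diff K S (op_scale K z id) x) = x \<and> op_diff K S (op_scale K z id) (R x) = x)}"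

text \<open>Evaluation of a polynomial at an operator by Horner's scheme.\<close>

definition poly_op :: "'k cspace \<Rightarrow> complex poly \<Rightarrow> ('k \<Rightarrow> 'k) \<Rightarrow> 'k \<Rightarrow> 'k" where
  "poly_op K p S =
     fold_coeffs (\<lambda>a F. op_add K (op_scale K a id) (S \<circ> F)) p (op_scale K 0 id)"

text \<open>\<open>cfc K f S\<close> is the operator \<open>f(S)\<close> for self-adjoint \<open>S\<close> and \<open>f\<close> continuous on the spectrum
  of \<open>S\<close>: the limit in operator norm of \<open>p\<^sub>n(S)\<close> for polynomials \<open>p\<^sub>n\<close> converging to \<open>f\<close> uniformly
  on the spectrum.  The spectrum is a compact set of reals, so such polynomials exist and the
  limit is determined on \<open>pts K\<close>; values outside \<open>pts K\<close> play no role.\<close>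

definition cfc :: "'k cspace \<Rightarrow> (complex \<Rightarrow> complex) \<Rightarrow> ('k \<Rightarrow> 'k) \<Rightarrow> 'k \<Rightarrow> 'k" where
  "cfc K f S = (SOME Q. Q \<in> bounded_ops K \<and>
     (\<forall>p. uniform_limit (spectrum K S) (\<lambda>n. poly (p n)) f sequentially \<longrightarrow>
        (\<lambda>n. op_norm K (op_diff K (poly_op K (p n) S) Q)) \<longlonglongrightarrow> 0))"

definition pos_power :: "'k cspace \<Rightarrow> ('k \<Rightarrow> 'k) \<Rightarrow> real \<Rightarrow> 'k \<Rightarrow> 'k" where
  "pos_power K S s = cfc K (\<lambda>z. complex_of_real (Re z powr s)) S"


section \<open>The completion of \<open>H / ker A\<close>\<close>

text \<open>Points are \<open>A\<close>-Cauchy sequences in \<open>H\<close> modulo sequences tending to \<open>0\<close> in \<open>A\<close>-seminorm.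
  As \<open>ker A\<close> is the null space of the seminorm, this contains the passage to \<open>H / ker A\<close>.\<close>

definition CauchyA :: "('a::complex_inner \<Rightarrow> 'a) \<Rightarrow> (nat \<Rightarrow> 'a) set" where
  "CauchyA A = {X. \<forall>e>0. \<exists>N. \<forall>m\<ge>N. \<forall>n\<ge>N. normA A (X m - X n) < e}"

definition eqA :: "('a::complex_inner \<Rightarrow> 'a) \<Rightarrow> ((nat \<Rightarrow> 'a) \<times> (nat \<Rightarrow> 'a)) set" where
  "eqA A = {(X, Y). X \<in> CauchyA A \<and> Y \<in> CauchyA A \<and> (\<lambda>n. normA A (X n - Y n)) \<longlonglongrightarrow> 0}"

definition completionA :: "('a::complex_inner \<Rightarrow> 'a) \<Rightarrow> (nat \<Rightarrow> 'a) set cspace" where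
  "completionA A = \<lparr>
     pts = CauchyA A // eqA A,
     add = (\<lambda>U V. \<Union>X\<in>U. \<Union>Y\<in>V. eqA A `` {\<lambda>n. X n + Y n}),
     scale = (\<lambda>c U. \<Union>X\<in>U. eqA A `` {\<lambda>n. c *\<^sub>C X n}),
     ip = (\<lambda>U V. THE z. \<forall>X\<in>U. \<forall>Y\<in>V. (\<lambda>n. cinnerA A (X n) (Y n)) \<longlonglongrightarrow> z)\<rparr>"

text \<open>The bounded operator on the completion induced by an \<open>A\<close>-bounded operator \<open>P\<close>.\<close>

definition induced_op ::
  "('a::complex_inner \<Rightarrow> 'a) \<Rightarrow> ('a \<Rightarrow> 'a) \<Rightarrow> (nat \<Rightarrow> 'a) set \<Rightarrow> (nat \<Rightarrow> 'a) set" where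
  "induced_op A P U = (\<Union>X\<in>U. eqA A `` {\<lambda>n. P (X n)})"

text \<open>The \<open>A\<close>-seminorm of \<open>P\<^sup>s + Q\<^sup>s\<close> for \<open>A\<close>-positive \<open>P\<close>, \<open>Q\<close>: ordinary powers in \<open>B(H)\<close> and the
  \<open>A\<close>-operator seminorm for integer \<open>s\<close>, functional calculus and the operator norm on the
  completion for all other \<open>s\<close>.\<close>

definition power_sum_seminormA ::
  "('a::chilbert_space \<Rightarrow> 'a) \<Rightarrow> ('a \<Rightarrow> 'a) \<Rightarrow> ('a \<Rightarrow> 'a) \<Rightarrow> real \<Rightarrow> real" where
  "power_sum_seminormA A P Q s =
     (if s \<in> \<nat> then onormA A (\<lambda>x. (P ^^ nat \<lfloor>s\<rfloor>) x + (Q ^^ nat \<lfloor>s\<rfloor>) x)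
      else op_norm (completionA A)
        (op_add (completionA A)
          (pos_power (completionA A) (induced_op A P) s)
          (pos_power (completionA A) (induced_op A Q) s)))"

end

theory Submission
  imports Defs "HOL-Computational_Algebra.Fundamental_Theorem_Algebra"
begin

text \<open>
  Fix \<open>x\<close> with \<open>\<parallel>x\<parallel>\<^sub>A = 1\<close> and put \<open>N = \<parallel>T x\<parallel>\<^sub>A \<parallel>T\<^sup>\<sharp> x\<parallel>\<^sub>A\<close> and \<open>m = \<bar>\<langle>T\<^sup>2 x, x\<rangle>\<^sub>A\<bar>\<close>, so that \<open>m \<le> N\<close> by
  Cauchy-Schwarz.  Buzano's inequality (\<open>Buzano_A\<close>) gives \<open>\<bar>\<langle>T x, x\<rangle>\<^sub>A\<bar>\<^sup>2 \<le> (N + m) / 2\<close>, and convexity of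
  \<open>t\<^sup>2\<^sup>r\<close> turns this into \<open>\<bar>\<langle>T x, x\<rangle>\<^sub>A\<bar>\<^sup>4\<^sup>r \<le> (N\<^sup>2\<^sup>r + m\<^sup>2\<^sup>r) / 2\<close>.  As \<open>m \<le> N\<close>, \<open>\<delta>\<^sub>1 + \<delta>\<^sub>2 = 1\<close> and
  \<open>\<delta>\<^sub>1 \<ge> 1 / 2\<close>, the right side is at most \<open>\<delta>\<^sub>1 N\<^sup>2\<^sup>r + \<delta>\<^sub>2 m\<^sup>2\<^sup>r\<close>.  Here \<open>m\<close> is at most the numerical radius
  of \<open>T\<^sup>2\<close>, while with \<open>P = T\<^sup>\<sharp> T\<close> and \<open>Q = T T\<^sup>\<sharp>\<close> the arithmetic-geometric mean inequality and
  McCarthy's inequality \<open>\<langle>P x, x\<rangle>\<^sup>r \<le> \<langle>P\<^sup>r x, x\<rangle>\<close> bound \<open>N\<^sup>2\<^sup>r = \<langle>P x, x\<rangle>\<^sup>r \<langle>Q x, x\<rangle>\<^sup>r\<close> by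
  \<open>\<parallel>P\<^sup>r + Q\<^sup>r\<parallel>\<^sub>A\<^sup>2 / 4\<close> (\<open>McCarthy_power_sum\<close>).

  The work lies in making the terms of this argument meaningful.

  Every supremum has to be over a bounded set, so \<open>T\<close> and \<open>T\<^sup>\<sharp>\<close> must be bounded for the seminorm.
  The operator \<open>T\<^sup>\<sharp>\<close> is bounded on the original space by Baire's theorem (\<open>sharpA_bounded\<close>), and
  Krein's iteration (\<open>symmetric_imp_normA_le\<close>) transfers the bound of \<open>T\<^sup>\<sharp> T\<close> to the seminorm.

  For real \<open>r\<close> the power \<open>P\<^sup>r\<close> is defined by the functional calculus of the operator \<open>S\<close> induced by
  \<open>P\<close> on the completion.  Its existence rests on the estimate that the norm of \<open>p(P)\<close> is at most the
  supremum of \<open>\<bar>p\<bar>\<close> over the spectrum (\<open>normA_opoly_le\<close>).  This is proved on the original space, for the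
  seminorm: with \<open>L\<close> the norm of \<open>p(P)\<close>, the operator \<open>p(P)\<^sup>* p(P) - L\<^sup>2\<close> is not bounded below, so,
  unless \<open>p\<^sup>* p\<close> is constant, one of its linear factors \<open>P - t\<close> is not bounded below either, and
  \<open>\<bar>p(t)\<bar> = L\<close>.
  All operators needed on the completion are limits of polynomials of \<open>S\<close>, and such a limit acts on a
  Cauchy sequence \<open>X\<close> as \<open>n \<mapsto> p\<^sub>n(P) X\<^sub>n\<close>; this yields the inverse of \<open>S - t\<close> off \<open>[0, M]\<close> as well as
  \<open>P\<^sup>r\<close>.  McCarthy's inequality follows from the same norm estimate, applied to a polynomial
  approximation of \<open>t\<^sup>r\<close> minus its supporting line at \<open>\<langle>P x, x\<rangle>\<close>.
\<close>


section \<open>Riesz representation and orthogonal projection\<close>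

lemma quadratic_nonneg_imp_discriminant:
  fixes a b d :: real
  assumes "\<And>t. a + 2 * t * b + t\<^sup>2 * d \<ge> 0"
  shows "b\<^sup>2 \<le> a * d"
proof (cases "d = 0")
  case True
  show ?thesis
  proof (cases "b = 0")
    case False
    have "a + 2 * (- (a + 1) / (2 * b)) * b \<ge> 0"
      using assms[of "- (a + 1) / (2 * b)"] True by simp
    then show ?thesis using False by (simp add: field_simps)
  qed (use True in simp)
next
  case False
  have "d > 0"
  proof (rule ccontr)
    assume "\<not> d > 0"
    then have d: "d < 0" using False by simp
    define t where "t = sqrt ((\<bar>a\<bar> + 1) / - d)"
    have "t\<^sup>2 = (\<bar>a\<bar> + 1) / - d"
      unfolding t_def using d by (intro real_sqrt_pow2 divide_nonneg_pos) auto
    then have "t\<^sup>2 * d = - (\<bar>a\<bar> + 1)" using d by simp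
    then show False using assms[of t] assms[of "-t"] by (simp add: algebra_simps)
  qed
  have "a + 2 * (-b/d) * b + (-b/d)\<^sup>2 * d = a - b\<^sup>2 / d"
    using False by (simp add: power2_eq_square field_simps)
  then have "b\<^sup>2 / d \<le> a" using assms[of "-b/d"] by simp
  then show ?thesis using \<open>d > 0\<close> by (simp add: field_simps)
qed

text \<open>The functional \<open>\<parallel>x\<parallel>\<^sup>2 - 2 f x\<close> is bounded below, its minimising sequences are Cauchy by the
  parallelogram law, and the vanishing of its first variation at the minimiser is the
  representation of \<open>f\<close>.  On the whole space this is the Riesz theorem; applied to
  \<open>f x = x \<bullet> z\<close> it gives the orthogonal projection of \<open>z\<close>.\<close>

lemma Riesz_on_subspace:
  fixes f :: "'a::{real_inner,complete_space} \<Rightarrow> real"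
  assumes M: "subspace M" "closed M" and f: "bounded_linear f"
  shows "\<exists>y\<in>M. \<forall>x\<in>M. f x = x \<bullet> y"
proof -
  interpret f: bounded_linear f by fact
  define J where "J x = x \<bullet> x - 2 * f x" for x
  obtain B where B: "\<And>x. \<bar>f x\<bar> \<le> norm x * B"
    using f.bounded by auto
  have J_ge: "J x \<ge> - B\<^sup>2" for x
  proof -
    have "0 \<le> (norm x - B)\<^sup>2" by simp
    then have "norm x ^ 2 - 2 * (norm x * B) \<ge> - B\<^sup>2"
      by (simp add: power2_eq_square algebra_simps)
    then show ?thesis using B[of x] by (simp add: J_def dot_square_norm)
  qed
  have bdd: "bdd_below (J ` M)"
    using J_ge by (intro bdd_belowI[of _ "- B\<^sup>2"]) auto
  have M0: "0 \<in> M" using M subspace_0 by blast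
  define m where "m = Inf (J ` M)"
  have m_le: "m \<le> J x" if "x \<in> M" for x
    unfolding m_def using that bdd by (intro cInf_lower) auto
  have "\<exists>x\<in>M. J x < m + 1 / Suc n" for n
  proof -
    have "Inf (J ` M) < m + 1 / Suc n" unfolding m_def by simp
    then show ?thesis using bdd M0 by (subst (asm) cInf_less_iff) auto
  qed
  then obtain X where X: "\<And>n. X n \<in> M" "\<And>n. J (X n) < m + 1 / Suc n" by metis
  have par: "norm (x - y) ^ 2 \<le> 2 * (J x - m) + 2 * (J y - m)" if "x \<in> M" "y \<in> M" for x y
  proof -
    have "(1/2) *\<^sub>R (x + y) \<in> M" using M that by (simp add: subspace_add subspace_scale)
    from m_le[OF this] show ?thesis
      by (simp add: J_def f.add f.scaleR inner_add inner_diff power2_norm_eq_inner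
          inner_commute algebra_simps)
  qed
  have "Cauchy X"
  proof (rule metric_CauchyI)
    fix e :: real assume e: "e > 0"
    obtain N where N: "1 / Suc N < e\<^sup>2 / 4"
      using nat_approx_posE[of "e\<^sup>2/4"] e by auto
    show "\<exists>M. \<forall>m\<ge>M. \<forall>n\<ge>M. dist (X m) (X n) < e"
    proof (intro exI allI impI)
      fix k n assume kn: "k \<ge> N" "n \<ge> N"
      have "1 / Suc k \<le> 1 / Suc N" "1 / Suc n \<le> 1 / Suc N"
        using kn by (auto simp: field_simps)
      then have "J (X k) - m < e\<^sup>2 / 4" "J (X n) - m < e\<^sup>2 / 4"
        using X(2)[of k] X(2)[of n] N by linarith+
      then have "2 * (J (X k) - m) + 2 * (J (X n) - m) < e\<^sup>2" by simp
      then have "norm (X k - X n) ^ 2 < e\<^sup>2"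
        using par[OF X(1)[of k] X(1)[of n]] by (rule order.strict_trans1[rotated])
      then show "dist (X k) (X n) < e"
        using e by (simp add: dist_norm power_less_imp_less_base)
    qed
  qed
  then obtain y where y: "X \<longlonglongrightarrow> y" using Cauchy_convergent convergent_def by blast
  have yM: "y \<in> M" using M(2) X(1) y closed_sequentially by blast
  have "(\<lambda>n. J (X n)) \<longlonglongrightarrow> J y"
    unfolding J_def by (intro tendsto_intros y f.tendsto)
  moreover have "(\<lambda>n. m + 1 / Suc n) \<longlonglongrightarrow> m + 0"
    by (intro tendsto_intros LIMSEQ_Suc[OF lim_1_over_n])
  ultimately have Jy: "J y \<le> m"
    using X(2) by (intro LIMSEQ_le[of "\<lambda>n. J (X n)" "J y" "\<lambda>n. m + 1 / Suc n" m])
      (auto intro!: exI[of _ 0] less_imp_le)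
  have "f x = x \<bullet> y" if x: "x \<in> M" for x
  proof -
    have "0 + 2 * t * (x \<bullet> y - f x) + t\<^sup>2 * (x \<bullet> x) \<ge> 0" for t
    proof -
      have "y + t *\<^sub>R x \<in> M" using M x yM by (simp add: subspace_add subspace_scale)
      from m_le[OF this] Jy have "J y \<le> J (y + t *\<^sub>R x)" by simp
      then show ?thesis
        by (simp add: J_def f.add f.scaleR inner_add inner_commute power2_eq_square algebra_simps)
    qed
    from quadratic_nonneg_imp_discriminant[OF this] show ?thesis by simp
  qed
  with yM show ?thesis by blast
qed

lemma orthogonal_projection:
  fixes M :: "'a::{real_inner,complete_space} set"
  assumes "subspace M" "closed M"
  shows "\<exists>p\<in>M. \<forall>x\<in>M. x \<bullet> (z - p) = 0"
  using Riesz_on_subspace[OF assms bounded_linear_inner_left[of z]] by (simp add: inner_diff_right)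


section \<open>Complex inner product spaces and adjoints\<close>

lemma scaleC_of_real: "complex_of_real a *\<^sub>C x = a *\<^sub>R x"
  by (simp add: scaleR_scaleC)

lemma scaleC_one [simp]: "1 *\<^sub>C x = x"
  using scaleC_of_real[of 1 x] by simp

lemma scaleC_zero_left [simp]: "0 *\<^sub>C x = 0"
  using scaleC_of_real[of 0 x] by simp

lemma scaleC_zero_right [simp]: "c *\<^sub>C (0::'a::complex_inner) = 0"
  using scaleC_add_right[of c "0::'a" 0] by simp

lemma scaleC_minus_one [simp]: "(-1) *\<^sub>C x = - x"
  using scaleC_of_real[of "-1" x] by simp

lemma scaleC_minus_left: "(- c) *\<^sub>C x = - (c *\<^sub>C x)"
  using scaleC_add_left[of c "-c" x] by (simp add: eq_neg_iff_add_eq_0 add.commute)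

lemma cinner_add_right: "cinner x (y + z) = cinner x y + cinner x z"
  by (subst (1 2 3) cinner_commute) (simp add: cinner_add_left)

lemma cinner_scaleC_right: "cinner x (c *\<^sub>C y) = cnj c * cinner x y"
  by (subst (1 2) cinner_commute) (simp add: cinner_scaleC_left)

lemma cinner_zero_left [simp]: "cinner 0 (x::'a::complex_inner) = 0"
  using cinner_add_left[of "0::'a" 0 x] by simp

lemma cinner_zero_right [simp]: "cinner (x::'a::complex_inner) 0 = 0"
  using cinner_add_right[of x "0::'a" 0] by simp

lemma cinner_minus_left: "cinner (- x) (y::'a::complex_inner) = - cinner x y"
  using cinner_add_left[of x "-x" y] by (simp add: eq_neg_iff_add_eq_0 add.commute)

lemma cinner_minus_right: "cinner x (- (y::'a::complex_inner)) = - cinner x y"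
  using cinner_add_right[of x y "-y"] by (simp add: eq_neg_iff_add_eq_0 add.commute)

lemma cinner_diff_left: "cinner (x - y) (z::'a::complex_inner) = cinner x z - cinner y z"
  using cinner_add_left[of x "-y" z] by (simp add: cinner_minus_left)

lemma cinner_diff_right: "cinner x (y - (z::'a::complex_inner)) = cinner x y - cinner x z"
  using cinner_add_right[of x y "-z"] by (simp add: cinner_minus_right)

lemma cinner_eq_0I:
  fixes x :: "'a::complex_inner"
  assumes "cinner x x = 0"
  shows "x = 0"
  using assms inner_cinner[of x x] by simp

text \<open>The real part of a sesquilinear form determines it, because \<open>Im z = Re (- \<i> z)\<close>.\<close>

lemma cinner_eq_if_inner_eq:
  assumes "\<And>c. (c *\<^sub>C x) \<bullet> y = (c *\<^sub>C u) \<bullet> v"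
  shows "cinner x y = cinner u v"
proof (rule complex_eqI)
  show "Re (cinner x y) = Re (cinner u v)"
    using assms[of 1] by (simp only: inner_cinner scaleC_one)
  have "Re (\<i> * cinner x y) = Re (\<i> * cinner u v)"
    using assms[of \<i>] by (simp only: inner_cinner cinner_scaleC_left)
  then show "Im (cinner x y) = Im (cinner u v)" by simp
qed

lemma cnj_mult_self: "cnj z * z = complex_of_real ((cmod z)\<^sup>2)"
  by (metis complex_norm_square mult.commute of_real_power)

lemma norm_scaleC: "norm (c *\<^sub>C x) = cmod c * norm x"
proof -
  have "(norm (c *\<^sub>C x))\<^sup>2 = Re (cnj c * c * cinner x x)"
    by (simp add: power2_norm_eq_inner inner_cinner cinner_scaleC_left cinner_scaleC_right mult.assoc
        mult.left_commute)
  also have "cnj c * c = of_real ((cmod c)\<^sup>2)"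
    by (rule cnj_mult_self)
  also have "Re (of_real ((cmod c)\<^sup>2) * cinner x x) = (cmod c * norm x)\<^sup>2"
    by (simp add: power2_norm_eq_inner inner_cinner power_mult_distrib)
  finally show ?thesis by (simp add: power2_eq_iff_nonneg)
qed

lemma bounded_clinearI:
  assumes add: "\<And>x y. S (x + y) = S x + S y" and scale: "\<And>c x. S (c *\<^sub>C x) = c *\<^sub>C S x"
    and bd: "\<And>x. norm (S x) \<le> norm x * b"
  shows "bounded_clinear S"
  unfolding bounded_clinear_def
proof (intro conjI allI)
  show "bounded_linear S"
    by (rule bounded_linear_intro[OF add _ bd]) (metis scale scaleR_scaleC)
qed (rule scale)

lemma cinner_right_eqI:
  fixes u v :: "'a::complex_inner"
  assumes "\<And>x. cinner x u = cinner x v"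
  shows "u = v"
  using cinner_eq_0I[of "u - v"] assms by (simp add: cinner_diff_right)

text \<open>Riesz represents the real functional \<open>x \<mapsto> T x \<bullet> y\<close>; complex linearity of \<open>T\<close> lifts the
  resulting identity from real parts to complex inner products.\<close>

lemma cadjoint_exists:
  fixes T :: "'a::chilbert_space \<Rightarrow> 'a"
  assumes "bounded_clinear T"
  shows "\<exists>S. bounded_clinear S \<and> (\<forall>x y. cinner (T x) y = cinner x (S y))"
proof -
  interpret T: bounded_linear T using assms by (simp add: bounded_clinear_def)
  have Tc: "T (c *\<^sub>C x) = c *\<^sub>C T x" for c x using assms by (simp add: bounded_clinear_def)
  have "\<forall>y. \<exists>s. \<forall>x. T x \<bullet> y = x \<bullet> s"
  proof
    fix y
    have "bounded_linear (\<lambda>x. T x \<bullet> y)"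
      by (rule bounded_linear_compose[OF bounded_linear_inner_left T.bounded_linear])
    from Riesz_on_subspace[OF subspace_UNIV closed_UNIV this]
    show "\<exists>s. \<forall>x. T x \<bullet> y = x \<bullet> s" by simp
  qed
  from choice[OF this] obtain S where "\<forall>y x. T x \<bullet> y = x \<bullet> S y" ..
  then have S: "T x \<bullet> y = x \<bullet> S y" for x y by blast
  have adj: "cinner (T x) y = cinner x (S y)" for x y
    by (rule cinner_eq_if_inner_eq) (simp only: S flip: Tc)
  obtain B where B: "B \<ge> 0" "\<And>x. norm (T x) \<le> norm x * B" using T.nonneg_bounded by auto
  have "norm (S y) \<le> norm y * B" for y
  proof (cases "S y = 0")
    case False
    have "norm (S y) * norm (S y) = T (S y) \<bullet> y"
      by (simp add: S power2_norm_eq_inner flip: power2_eq_square)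
    also have "\<dots> \<le> norm (T (S y)) * norm y" by (rule norm_cauchy_schwarz)
    also have "\<dots> \<le> norm (S y) * B * norm y" by (intro mult_right_mono B) simp
    finally show ?thesis using False by (simp add: mult.assoc mult.commute[of B])
  qed (use B in simp)
  moreover have "S (y + z) = S y + S z" for y z
    by (rule cinner_right_eqI) (simp add: cinner_add_right flip: adj)
  moreover have "S (c *\<^sub>C y) = c *\<^sub>C S y" for c y
    by (rule cinner_right_eqI) (simp add: cinner_scaleC_right flip: adj)
  ultimately have "bounded_clinear S" by (intro bounded_clinearI)
  with adj show ?thesis by blast
qed

lemma cinner_cadjoint:
  fixes T :: "'a::chilbert_space \<Rightarrow> 'a"
  assumes "bounded_clinear T"
  shows "cinner (T x) y = cinner x (cadjoint T y)"
proof -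
  obtain S where S: "bounded_clinear S" "\<forall>x y. cinner (T x) y = cinner x (S y)"
    using cadjoint_exists[OF assms] by (elim exE conjE)
  have "cadjoint T = S"
    unfolding cadjoint_def
  proof (rule the_equality)
    show "bounded_clinear S \<and> (\<forall>x y. cinner (T x) y = cinner x (S y))"
      by (rule conjI[OF S])
    fix S' assume S': "bounded_clinear S' \<and> (\<forall>x y. cinner (T x) y = cinner x (S' y))"
    show "S' = S"
    proof (rule ext, rule cinner_right_eqI)
      fix x y
      have "cinner x (S' y) = cinner (T x) y" using S' by simp
      also have "\<dots> = cinner x (S y)" using S(2) by simp
      finally show "cinner x (S' y) = cinner x (S y)" .
    qed
  qed
  with S(2) show ?thesis by simp
qed


section \<open>The semi-inner product and operators bounded for its seminorm\<close>

lemma op_additive_simps: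
  assumes "bounded_clinear F"
  shows "F (x + y) = F x + F y" "F (x - y) = F x - F y" "F (c *\<^sub>C x) = c *\<^sub>C F x" "F 0 = 0"
    "F (- x) = - F x"
proof -
  interpret bounded_linear F using assms by (simp add: bounded_clinear_def)
  show "F (x + y) = F x + F y" "F (x - y) = F x - F y" "F 0 = 0" "F (- x) = - F x"
    by (fact add diff zero neg)+
  show "F (c *\<^sub>C x) = c *\<^sub>C F x" using assms by (simp add: bounded_clinear_def)
qed

locale positive_operator =
  fixes A :: "'h::chilbert_space \<Rightarrow> 'h"
  assumes positive: "positive_op A"
begin

lemma clinear_A: "bounded_clinear A"
  using positive by (simp add: positive_op_def)

lemmas A_simps = op_additive_simps[OF clinear_A]

lemma cinnerA_add_left: "cinnerA A (x + y) z = cinnerA A x z + cinnerA A y z"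
  by (simp add: cinnerA_def A_simps cinner_add_left)

lemma cinnerA_add_right: "cinnerA A x (y + z) = cinnerA A x y + cinnerA A x z"
  by (simp add: cinnerA_def cinner_add_right)

lemma cinnerA_scale_left: "cinnerA A (c *\<^sub>C x) y = c * cinnerA A x y"
  by (simp add: cinnerA_def A_simps cinner_scaleC_left)

lemma cinnerA_scale_right: "cinnerA A x (c *\<^sub>C y) = cnj c * cinnerA A x y"
  by (simp add: cinnerA_def cinner_scaleC_right)

lemma cinnerA_zero [simp]: "cinnerA A 0 x = 0" "cinnerA A x 0 = 0"
  by (simp_all add: cinnerA_def A_simps)

lemma cinnerA_minus: "cinnerA A (- x) y = - cinnerA A x y" "cinnerA A x (- y) = - cinnerA A x y"
  by (simp_all add: cinnerA_def A_simps cinner_minus_left cinner_minus_right)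

lemma cinnerA_diff_left: "cinnerA A (x - y) z = cinnerA A x z - cinnerA A y z"
  by (simp add: cinnerA_def A_simps cinner_diff_left)

lemma cinnerA_diff_right: "cinnerA A x (y - z) = cinnerA A x y - cinnerA A x z"
  by (simp add: cinnerA_def cinner_diff_right)

lemmas cinnerA_simps = cinnerA_add_left cinnerA_add_right cinnerA_scale_left cinnerA_scale_right
  cinnerA_minus cinnerA_diff_left cinnerA_diff_right

lemma cinnerA_self_nonneg: "Im (cinnerA A x x) = 0" "Re (cinnerA A x x) \<ge> 0"
  using positive by (auto simp: positive_op_def cinnerA_def complex_nonneg_Reals_iff)

lemma normA_nonneg [simp]: "normA A x \<ge> 0"
  by (simp add: normA_def cinnerA_self_nonneg)

lemma normA_sq: "(normA A x)\<^sup>2 = Re (cinnerA A x x)"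
  by (simp add: normA_def cinnerA_self_nonneg)

lemma cinnerA_self: "cinnerA A x x = complex_of_real ((normA A x)\<^sup>2)"
  by (simp add: complex_eq_iff normA_sq cinnerA_self_nonneg)

text \<open>In a complex space a form with real diagonal is Hermitian: polarise with \<open>x + y\<close> and
  \<open>x + \<i> y\<close>.\<close>

lemma cinnerA_commute: "cinnerA A x y = cnj (cinnerA A y x)"
proof (rule complex_eqI)
  have "Im (cinnerA A (x + y) (x + y)) = 0" by (rule cinnerA_self_nonneg)
  then show "Im (cinnerA A x y) = Im (cnj (cinnerA A y x))"
    by (simp add: cinnerA_simps cinnerA_self_nonneg)
  have "Im (cinnerA A (x + \<i> *\<^sub>C y) (x + \<i> *\<^sub>C y)) = 0" by (rule cinnerA_self_nonneg)
  then show "Re (cinnerA A x y) = Re (cnj (cinnerA A y x))"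
    by (simp add: cinnerA_simps cinnerA_self_nonneg)
qed

lemma A_self_adjoint: "cinner (A x) y = cinner x (A y)"
  using cinnerA_commute[of x y] cinner_commute[of x "A y"] by (simp add: cinnerA_def)

lemma Cauchy_Schwarz_A: "cmod (cinnerA A x y) \<le> normA A x * normA A y"
proof (cases "cinnerA A x y = 0")
  case False
  define z where "z = cinnerA A x y"
  \<comment> \<open>the phase of \<open>\<langle>x, y\<rangle>\<close>, which makes the cross term of \<open>\<parallel>x + t c y\<parallel>\<^sup>2\<close> equal to \<open>2 t \<bar>\<langle>x, y\<rangle>\<bar>\<close>\<close>
  define c where "c = z / complex_of_real (cmod z)"
  have z: "cmod z \<noteq> 0" using False by (simp add: z_def)
  have c1: "c * cnj c = 1"
    using z by (simp add: c_def complex_norm_square[symmetric] power2_eq_square)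
  have cz: "cnj c * z = complex_of_real (cmod z)"
    using z by (simp add: c_def complex_norm_square[symmetric] power2_eq_square mult.commute)
  have "(normA A x)\<^sup>2 + 2 * t * cmod z + t\<^sup>2 * (normA A y)\<^sup>2 \<ge> 0" for t
  proof -
    have "cinnerA A (x + (t * c) *\<^sub>C y) (x + (t * c) *\<^sub>C y)
        = cinnerA A x x + t * (cnj c * cinnerA A x y) + t * (c * cinnerA A y x)
          + t\<^sup>2 * ((c * cnj c) * cinnerA A y y)"
      by (simp add: cinnerA_simps algebra_simps power2_eq_square)
    also have "c * cinnerA A y x = cnj (cnj c * z)"
      using cinnerA_commute[of y x] by (simp add: z_def)
    finally have "Re (cinnerA A (x + (t * c) *\<^sub>C y) (x + (t * c) *\<^sub>C y))
        = (normA A x)\<^sup>2 + 2 * t * cmod z + t\<^sup>2 * (normA A y)\<^sup>2"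
      by (simp add: c1 cz z_def[symmetric] cinnerA_self flip: of_real_power)
    then show ?thesis by (metis cinnerA_self_nonneg(2))
  qed
  from quadratic_nonneg_imp_discriminant[OF this]
  have "(cmod z)\<^sup>2 \<le> (normA A x * normA A y)\<^sup>2" by (simp add: power_mult_distrib)
  then show ?thesis unfolding z_def by (rule power2_le_imp_le) simp
qed simp

lemma Re_cinnerA_le: "Re (cinnerA A x y) \<le> normA A x * normA A y"
  using Cauchy_Schwarz_A[of x y] complex_Re_le_cmod[of "cinnerA A x y"] by simp

lemma normA_triangle: "normA A (x + y) \<le> normA A x + normA A y"
proof (rule power2_le_imp_le)
  have "(normA A (x + y))\<^sup>2 = (normA A x)\<^sup>2 + 2 * Re (cinnerA A x y) + (normA A y)\<^sup>2"
    using cinnerA_commute[of y x] by (simp add: normA_sq cinnerA_simps)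
  then show "(normA A (x + y))\<^sup>2 \<le> (normA A x + normA A y)\<^sup>2"
    using Re_cinnerA_le[of x y] by (simp add: power2_sum algebra_simps)
qed simp

lemma normA_scale: "normA A (c *\<^sub>C x) = cmod c * normA A x"
proof (rule power2_eq_imp_eq)
  have "cinnerA A (c *\<^sub>C x) (c *\<^sub>C x) = (c * cnj c) * cinnerA A x x"
    by (simp add: cinnerA_simps)
  also have "c * cnj c = complex_of_real ((cmod c)\<^sup>2)" by (metis complex_norm_square of_real_power)
  finally show "(normA A (c *\<^sub>C x))\<^sup>2 = (cmod c * normA A x)\<^sup>2"
    by (simp add: normA_sq cinnerA_self_nonneg power_mult_distrib)
qed simp_all

lemma normA_zero [simp]: "normA A 0 = 0"
  by (simp add: normA_def)

lemma normA_minus: "normA A (- x) = normA A x"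
  using normA_scale[of "-1" x] by simp

lemma normA_minus_commute: "normA A (x - y) = normA A (y - x)"
  using normA_minus[of "x - y"] by simp

lemma normA_triangle_diff: "normA A (x - z) \<le> normA A (x - y) + normA A (y - z)"
  using normA_triangle[of "x - y" "y - z"] by simp

lemma abs_normA_diff_le: "\<bar>normA A x - normA A y\<bar> \<le> normA A (x - y)"
  using normA_triangle[of "x - y" y] normA_triangle[of "y - x" x] normA_minus_commute[of x y] by simp

lemma normA_le_norm: "\<exists>C>0. \<forall>x. normA A x \<le> C * norm x"
proof -
  interpret A: bounded_linear A using clinear_A by (simp add: bounded_clinear_def)
  obtain B where B: "B > 0" "\<And>x. norm (A x) \<le> norm x * B" using A.pos_bounded by auto
  have "normA A x \<le> sqrt B * norm x" for x
  proof (rule power2_le_imp_le)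
    have "(normA A x)\<^sup>2 = A x \<bullet> x" by (simp add: normA_sq cinnerA_def inner_cinner)
    also have "\<dots> \<le> norm (A x) * norm x" by (rule norm_cauchy_schwarz)
    also have "\<dots> \<le> norm x * B * norm x" by (intro mult_right_mono B) simp
    also have "\<dots> = (sqrt B * norm x)\<^sup>2"
      using B(1) by (simp add: power_mult_distrib) (simp add: power2_eq_square)
    finally show "(normA A x)\<^sup>2 \<le> (sqrt B * norm x)\<^sup>2" .
  qed (use B in simp)
  then show ?thesis using B(1) real_sqrt_gt_zero by blast
qed

definition bounded_A :: "('h \<Rightarrow> 'h) \<Rightarrow> bool" where
  "bounded_A F \<longleftrightarrow> (\<exists>B\<ge>0. \<forall>x. normA A (F x) \<le> B * normA A x)"

text \<open>Krein's argument: symmetry gives \<open>\<parallel>P^k x\<parallel>\<^sup>2 \<le> \<parallel>P^(2 k) x\<parallel> \<parallel>x\<parallel>\<close> in the seminorm, so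
  \<open>\<parallel>P x\<parallel> / \<parallel>x\<parallel>\<close> is at most the \<open>k\<close>-th root of \<open>\<parallel>P^k x\<parallel> / \<parallel>x\<parallel>\<close> for every power \<open>k\<close> of \<open>2\<close>.
  The growth of \<open>\<parallel>P^k x\<parallel>\<close> is controlled by the norm of the original space.\<close>

lemma symmetric_imp_normA_le:
  assumes sym: "\<And>x y. cinnerA A (P x) y = cinnerA A x (P y)"
    and B: "B > 0" "\<And>x. norm (P x) \<le> B * norm x"
  shows "normA A (P x) \<le> B * normA A x"
proof -
  define a where "a n = normA A ((P ^^ n) x)" for n
  have sym_pow: "cinnerA A ((P ^^ n) u) v = cinnerA A u ((P ^^ n) v)" for n u v
  proof (induction n arbitrary: v)
    case (Suc n)
    then show ?case by (simp add: sym) (simp add: funpow_swap1)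
  qed simp
  have a_sq: "(a n)\<^sup>2 \<le> a (2 * n) * normA A x" for n
  proof -
    have "(a n)\<^sup>2 = Re (cinnerA A ((P ^^ n) ((P ^^ n) x)) x)"
      unfolding a_def normA_sq by (simp only: sym_pow)
    also have "\<dots> \<le> a (2 * n) * normA A x"
      unfolding a_def mult_2 funpow_add o_apply by (rule Re_cinnerA_le)
    finally show ?thesis .
  qed
  show ?thesis
  proof (cases "normA A x = 0")
    case True
    then have "(a 1)\<^sup>2 \<le> 0" using a_sq[of 1] by simp
    then show ?thesis using True by (simp add: a_def)
  next
    case False
    define b where "b n = a n / normA A x" for n
    have nx: "normA A x > 0" using False normA_nonneg[of x] by linarith
    have b_nonneg: "b n \<ge> 0" for n by (simp add: b_def a_def)
    have b_sq: "(b n)\<^sup>2 \<le> b (2 * n)" for n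
      using a_sq[of n] nx by (simp add: b_def power_divide power2_eq_square field_simps)
    have b_pow: "b 1 ^ (2 ^ n) \<le> b (2 ^ n)" for n
    proof (induction n)
      case (Suc n)
      have "b 1 ^ (2 ^ Suc n) = (b 1 ^ (2 ^ n))\<^sup>2" unfolding power_Suc by (rule power_even_eq)
      also have "\<dots> \<le> (b (2 ^ n))\<^sup>2" by (intro power_mono Suc) (simp add: b_nonneg)
      also have "\<dots> \<le> b (2 ^ Suc n)" using b_sq[of "2 ^ n"] by simp
      finally show ?case .
    qed simp
    obtain C where C: "C > 0" "\<And>x. normA A x \<le> C * norm x" using normA_le_norm by blast
    have norm_pow: "norm ((P ^^ n) x) \<le> B ^ n * norm x" for n
    proof (induction n)
      case (Suc n)
      have "norm ((P ^^ Suc n) x) \<le> B * norm ((P ^^ n) x)" using B(2) by simp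
      also have "\<dots> \<le> B * (B ^ n * norm x)" using Suc B(1) by simp
      finally show ?case by (simp add: mult.assoc)
    qed simp
    have growth: "(b 1 / B) ^ (2 ^ n) \<le> C * norm x / normA A x" for n
    proof -
      have "b (2 ^ n) \<le> C * (B ^ (2 ^ n) * norm x) / normA A x"
        unfolding b_def a_def using C norm_pow[of "2 ^ n"] nx
        by (intro divide_right_mono order_trans[OF C(2)] mult_left_mono) auto
      with b_pow[of n] have "b 1 ^ (2 ^ n) \<le> C * norm x / normA A x * B ^ (2 ^ n)"
        by (simp add: field_simps)
      then show ?thesis using B(1) by (simp add: power_divide pos_divide_le_eq)
    qed
    have "b 1 / B \<le> 1"
    proof (rule ccontr)
      assume "\<not> b 1 / B \<le> 1"
      then have q: "b 1 / B > 1" by simp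
      obtain n where n: "C * norm x / normA A x < (b 1 / B) ^ n"
        using real_arch_pow[OF q] by blast
      have "(b 1 / B) ^ n \<le> (b 1 / B) ^ (2 ^ n)"
        using q by (intro power_increasing less_imp_le[OF less_exp]) auto
      with n growth[of n] show False by linarith
    qed
    then show ?thesis using B(1) nx by (simp add: b_def a_def field_simps)
  qed
qed

end


section \<open>The adjoint for the semi-inner product\<close>

lemma subspace_closure:
  fixes S :: "'a::real_normed_vector set"
  assumes S: "subspace S"
  shows "subspace (closure S)"
proof (rule subspaceI)
  show "0 \<in> closure S" using subspace_0[OF S] closure_subset by blast
next
  fix x y assume "x \<in> closure S" "y \<in> closure S"
  then obtain f g where "\<And>n. f n \<in> S" "f \<longlonglongrightarrow> x" "\<And>n. g n \<in> S" "g \<longlonglongrightarrow> y"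
    unfolding closure_sequential by blast
  then show "x + y \<in> closure S"
    unfolding closure_sequential
    by (intro exI[of _ "\<lambda>n. f n + g n"]) (auto intro: tendsto_add subspace_add[OF S])
next
  fix c x assume "x \<in> closure S"
  then obtain f where "\<And>n. f n \<in> S" "f \<longlonglongrightarrow> x"
    unfolding closure_sequential by blast
  then show "c *\<^sub>R x \<in> closure S"
    unfolding closure_sequential
    by (intro exI[of _ "\<lambda>n. c *\<^sub>R f n"]) (auto intro: tendsto_scaleR subspace_scale[OF S])
qed

context positive_operator
begin

lemma continuous_A: "continuous_on S A"
  using clinear_A linear_continuous_on by (auto simp: bounded_clinear_def)

lemma subspace_ker_A: "subspace {z. A z = 0}"
  by (auto simp: subspace_def A_simps scaleR_scaleC)

lemma closed_ker_A: "closed {z. A z = 0}"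
  by (rule closed_Collect_eq[OF continuous_A continuous_on_const])

lemma A_self_adjoint_real: "A x \<bullet> y = x \<bullet> A y"
  by (simp add: inner_cinner A_self_adjoint)

lemma ker_complement_representative:
  "\<exists>x\<in>ortho_compl {z. A z = 0}. A x = A z"
proof -
  obtain p where p: "A p = 0" "\<And>u. A u = 0 \<Longrightarrow> u \<bullet> (z - p) = 0"
    using orthogonal_projection[OF subspace_ker_A closed_ker_A, of z] by auto
  have "cinner u (z - p) = cinner u 0" if "A u = 0" for u
    by (rule cinner_eq_if_inner_eq) (simp add: p(2) A_simps that)
  then have "z - p \<in> ortho_compl {z. A z = 0}"
    unfolding ortho_compl_def by (auto simp: cinner_commute[of "z - p"])
  moreover have "A (z - p) = A z" by (simp add: A_simps p)
  ultimately show ?thesis by blast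
qed

text \<open>A vector orthogonal to \<open>ker A\<close> lies in the closure of \<open>ran A\<close>, hence its norm is detected by
  testing against \<open>ran A\<close> only.\<close>

lemma norm_le_if_inner_range_le:
  assumes u: "u \<in> ortho_compl {z. A z = 0}" and n: "n \<ge> 0"
    and le: "\<And>v. u \<bullet> A v \<le> n * norm (A v)"
  shows "norm u \<le> n"
proof -
  have "linear A" using clinear_A by (simp add: bounded_clinear_def bounded_linear.linear)
  then have "subspace (closure (range A))"
    by (intro subspace_closure linear_subspace_image subspace_UNIV)
  from orthogonal_projection[OF this closed_closure, of u] obtain p where
    p: "p \<in> closure (range A)" "\<forall>x\<in>closure (range A). x \<bullet> (u - p) = 0" ..
  have "A (u - p) \<bullet> A (u - p) = A (A (u - p)) \<bullet> (u - p)"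
    by (simp add: A_self_adjoint_real)
  also have "\<dots> = 0"
    using p(2) closure_subset[THEN subsetD, OF rangeI] by (rule bspec)
  finally have "A (u - p) = 0" by simp
  then have "cinner u (u - p) = 0" using u by (simp add: ortho_compl_def)
  then have "u \<bullet> (u - p) = 0" by (simp add: inner_cinner)
  moreover have "p \<bullet> (u - p) = 0" using p(2,1) by (rule bspec)
  ultimately have "(u - p) \<bullet> (u - p) = 0" by (simp add: inner_diff_left)
  then have "u \<in> closure (range A)" using p(1) by simp
  then obtain y where y: "\<And>k. y k \<in> range A" "y \<longlonglongrightarrow> u"
    unfolding closure_sequential by blast
  have "u \<bullet> u \<le> n * norm u"
  proof (rule LIMSEQ_le)
    show "(\<lambda>k. u \<bullet> y k) \<longlonglongrightarrow> u \<bullet> u" by (intro tendsto_intros y)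
    show "(\<lambda>k. n * norm (y k)) \<longlonglongrightarrow> n * norm u" by (intro tendsto_intros y)
    have "u \<bullet> y k \<le> n * norm (y k)" for k using y(1)[of k] le by auto
    then show "\<exists>N. \<forall>k\<ge>N. u \<bullet> y k \<le> n * norm (y k)" by blast
  qed
  then have "norm u * norm u \<le> n * norm u"
    by (simp only: dot_square_norm power2_eq_square)
  then show ?thesis using n by (cases "u = 0") simp_all
qed

lemma ortho_compl_ker_eqI:
  assumes "x \<in> ortho_compl {z. A z = 0}" "y \<in> ortho_compl {z. A z = 0}" "A x = A y"
  shows "x = y"
proof -
  have "x - y \<in> ortho_compl {z. A z = 0}"
    using assms by (simp add: ortho_compl_def cinner_diff_left)
  moreover have "A (x - y) = 0" using assms by (simp add: A_simps)
  ultimately have "cinner (x - y) (x - y) = 0" by (simp add: ortho_compl_def)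
  from cinner_eq_0I[OF this] show ?thesis by simp
qed

text \<open>For \<open>T\<close> in \<open>B\<^sub>A\<close> the vector \<open>T\<^sup>* A y\<close> lies in \<open>ran A\<close>, and its preimage orthogonal to \<open>ker A\<close>
  is the value of the Moore-Penrose inverse: a residual in \<open>ran A\<close> orthogonal to \<open>ran A\<close> is zero.\<close>

lemma sharpA_properties:
  assumes T: "T \<in> BA A"
  shows "A (sharpA A T y) = cadjoint T (A y)"
    and "sharpA A T y \<in> ortho_compl {z. A z = 0}"
proof -
  have "cadjoint T (A y) \<in> range A" using T by (auto simp: BA_def)
  then obtain z where z: "cadjoint T (A y) = A z" by blast
  obtain x where x: "x \<in> ortho_compl {z. A z = 0}" "A x = A z"
    using ker_complement_representative by blast
  have "mp_inverse A (A z) = x"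
    unfolding mp_inverse_def
  proof (rule the_equality)
    show "x \<in> ortho_compl {z. A z = 0} \<and> A z - A x \<in> ortho_compl (range A)"
      using x by (auto simp: ortho_compl_def)
    fix x' assume x': "x' \<in> ortho_compl {z. A z = 0} \<and> A z - A x' \<in> ortho_compl (range A)"
    then have "A (x - x') \<in> ortho_compl (range A)" by (simp add: A_simps x)
    then have "cinner (A (x - x')) (A (x - x')) = 0" by (simp add: ortho_compl_def)
    then have "A (x - x') = 0" by (rule cinner_eq_0I)
    then have "A x' = A x" by (simp add: A_simps)
    with x(1) x' show "x' = x" by (blast intro: ortho_compl_ker_eqI)
  qed
  then have "sharpA A T y = x" by (simp add: sharpA_def z)
  with x z show "A (sharpA A T y) = cadjoint T (A y)" "sharpA A T y \<in> ortho_compl {z. A z = 0}"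
    by auto
qed

context
  fixes T assumes T: "T \<in> BA A"
begin

lemma clinear_T: "bounded_clinear T"
  using T by (simp add: BA_def)

lemma cinner_A_sharpA: "cinner (A (sharpA A T x)) y = cinner (A x) (T y)"
  using cinner_cadjoint[OF clinear_T, of y "A x"]
  by (simp add: sharpA_properties[OF T] cinner_commute[of _ y] cinner_commute[of _ "T y"])

lemma cinnerA_sharpA_left: "cinnerA A (sharpA A T x) y = cinnerA A x (T y)"
  by (simp add: cinnerA_def cinner_A_sharpA)

lemma cinnerA_sharpA_right: "cinnerA A (T x) y = cinnerA A x (sharpA A T y)"
  using cinnerA_sharpA_left[of y x] cinnerA_commute by metis

lemma sharpA_add: "sharpA A T (x + y) = sharpA A T x + sharpA A T y"
proof (rule ortho_compl_ker_eqI)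
  show "A (sharpA A T (x + y)) = A (sharpA A T x + sharpA A T y)"
    by (rule cinner_right_eqI, subst (1 2) cinner_commute)
      (simp add: A_simps cinner_A_sharpA cinner_add_left)
qed (use sharpA_properties(2)[OF T] in \<open>auto simp: ortho_compl_def cinner_add_left\<close>)

lemma sharpA_scale: "sharpA A T (c *\<^sub>C x) = c *\<^sub>C sharpA A T x"
proof (rule ortho_compl_ker_eqI)
  show "A (sharpA A T (c *\<^sub>C x)) = A (c *\<^sub>C sharpA A T x)"
    by (rule cinner_right_eqI, subst (1 2) cinner_commute)
      (simp add: A_simps cinner_A_sharpA cinner_scaleC_left)
qed (use sharpA_properties(2)[OF T] in \<open>auto simp: ortho_compl_def cinner_scaleC_left\<close>)

text \<open>Testing \<open>T\<^sup>\<sharp> y\<close> against \<open>ran A\<close> expresses \<open>\<parallel>T\<^sup>\<sharp> y\<parallel> \<le> n\<close> by inequalities continuous in \<open>y\<close>.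
  The sets where this holds are therefore closed and exhaust the space, and Baire's theorem gives
  one of them an interior point.\<close>

lemma sharpA_bounded: "bounded_clinear (sharpA A T)"
proof -
  define X where "X = sharpA A T"
  define E where "E n = {y. norm (X y) \<le> real n}" for n
  have X_A: "X y \<bullet> A v = y \<bullet> A (T v)" for y v
    by (simp add: inner_cinner X_def cinner_A_sharpA flip: A_self_adjoint)
  have E_eq: "E n = (\<Inter>v. {y. y \<bullet> A (T v) \<le> real n * norm (A v)})" for n
  proof (intro equalityI subsetI)
    fix y assume "y \<in> E n"
    then have "X y \<bullet> A v \<le> real n * norm (A v)" for v
      using norm_cauchy_schwarz[of "X y" "A v"] mult_right_mono[of "norm (X y)" "real n" "norm (A v)"]
      by (simp add: E_def)
    then show "y \<in> (\<Inter>v. {y. y \<bullet> A (T v) \<le> real n * norm (A v)})" by (simp add: X_A)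
  next
    fix y assume "y \<in> (\<Inter>v. {y. y \<bullet> A (T v) \<le> real n * norm (A v)})"
    then show "y \<in> E n"
      unfolding E_def mem_Collect_eq
      by (intro norm_le_if_inner_range_le) (simp_all add: X_A, simp add: X_def sharpA_properties[OF T])
  qed
  have E_closed: "closed (E n)" for n
    unfolding E_eq by (intro closed_INT ballI closed_Collect_le continuous_intros)
  have E_UNIV: "\<Union>(range E) = UNIV"
    using real_arch_simple by (auto simp: E_def)
  have "\<exists>n. interior (E n) \<noteq> {}"
  proof (rule ccontr)
    assume "\<not> ?thesis"
    then have "euclidean interior_of \<Union>(range E) = {}"
      using E_closed
      by (intro Baire_category_alt disjI1 completely_metrizable_space_euclidean) auto
    then show False unfolding E_UNIV by simp
  qed
  then obtain n where "interior (E n) \<noteq> {}" by blast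
  then obtain y where "y \<in> interior (E n)" by blast
  then obtain e where e: "e > 0" "ball y e \<subseteq> E n"
    by (auto simp: mem_interior)
  have X_add: "X (x + y) = X x + X y" for x y by (simp add: X_def sharpA_add)
  have X_scale: "X (c *\<^sub>C x) = c *\<^sub>C X x" for c x by (simp add: X_def sharpA_scale)
  have small: "norm (X z) \<le> 2 * real n" if "norm z < e" for z
  proof -
    have "X z = X (y + z) - X y" by (simp add: X_add)
    moreover have "norm (X (y + z)) \<le> n" "norm (X y) \<le> n"
      using e that by (auto simp: E_def dist_norm subset_iff)
    ultimately show ?thesis
      using norm_triangle_ineq4[of "X (y + z)" "X y"] by simp
  qed
  have "norm (X x) \<le> norm x * (4 * real n / e)" for x
  proof (cases "x = 0")
    case True
    then show ?thesis using X_scale[of 0 0] by simp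
  next
    case False
    define c where "c = complex_of_real (e / (2 * norm x))"
    have c: "cmod c = e / (2 * norm x)" using e unfolding c_def norm_of_real by simp
    have "norm (c *\<^sub>C x) < e" using False e by (simp add: norm_scaleC c)
    from small[OF this] have "e / (2 * norm x) * norm (X x) \<le> 2 * real n"
      by (simp add: X_scale norm_scaleC c)
    then show ?thesis using False e by (simp add: field_simps)
  qed
  then show ?thesis
    unfolding X_def using sharpA_add sharpA_scale by (intro bounded_clinearI)
qed

text \<open>As \<open>T\<^sup>\<sharp> T\<close> is symmetric for \<open>\<langle>\<cdot>,\<cdot>\<rangle>\<^sub>A\<close> and bounded, it is bounded for the seminorm, and
  \<open>\<parallel>T x\<parallel>\<^sub>A\<^sup>2 = \<langle>T\<^sup>\<sharp> T x, x\<rangle>\<^sub>A\<close> passes this on to \<open>T\<close>.\<close>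

lemma bounded_A_T: "bounded_A T"
proof -
  define P where "P = (\<lambda>x. sharpA A T (T x))"
  obtain B1 where B1: "B1 > 0" "\<And>x. norm (sharpA A T x) \<le> norm x * B1"
    using bounded_linear.pos_bounded[of "sharpA A T"] sharpA_bounded
    unfolding bounded_clinear_def by blast
  obtain B2 where B2: "B2 > 0" "\<And>x. norm (T x) \<le> norm x * B2"
    using bounded_linear.pos_bounded[of T] clinear_T unfolding bounded_clinear_def by blast
  have "norm (P x) \<le> (B2 * B1) * norm x" for x
  proof -
    have "norm (P x) \<le> norm (T x) * B1" unfolding P_def by (rule B1)
    also have "\<dots> \<le> norm x * B2 * B1" using B1(1) B2(2) by simp
    finally show ?thesis by (simp add: mult_ac)
  qed
  moreover have "cinnerA A (P x) y = cinnerA A x (P y)" for x y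
    by (simp add: P_def cinnerA_sharpA_left flip: cinnerA_sharpA_right)
  ultimately have P: "normA A (P x) \<le> (B2 * B1) * normA A x" for x
    by (intro symmetric_imp_normA_le) (use B1 B2 in auto)
  have "normA A (T x) \<le> sqrt (B2 * B1) * normA A x" for x
  proof (rule power2_le_imp_le)
    have "(normA A (T x))\<^sup>2 = Re (cinnerA A (P x) x)"
      by (simp add: normA_sq P_def cinnerA_sharpA_left)
    also have "\<dots> \<le> normA A (P x) * normA A x" by (rule Re_cinnerA_le)
    also have "\<dots> \<le> (B2 * B1) * normA A x * normA A x" by (intro mult_right_mono P) simp
    also have "\<dots> = (sqrt (B2 * B1) * normA A x)\<^sup>2"
      using B1(1) B2(1) by (simp add: power_mult_distrib) (simp add: power2_eq_square)
    finally show "(normA A (T x))\<^sup>2 \<le> (sqrt (B2 * B1) * normA A x)\<^sup>2" .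
  qed (use B1 B2 in simp)
  then show ?thesis unfolding bounded_A_def
    using B1 B2 by (intro exI[of _ "sqrt (B2 * B1)"]) simp
qed

lemma bounded_A_sharpA: "bounded_A (sharpA A T)"
proof -
  obtain B where B: "B \<ge> 0" "\<And>x. normA A (T x) \<le> B * normA A x"
    using bounded_A_T by (auto simp: bounded_A_def)
  have "normA A (sharpA A T x) \<le> B * normA A x" for x
  proof (cases "normA A (sharpA A T x) = 0")
    case False
    have "normA A (sharpA A T x) * normA A (sharpA A T x) = Re (cinnerA A x (T (sharpA A T x)))"
      by (simp add: normA_sq flip: power2_eq_square cinnerA_sharpA_left)
    also have "\<dots> \<le> normA A x * normA A (T (sharpA A T x))" by (rule Re_cinnerA_le)
    also have "\<dots> \<le> normA A x * (B * normA A (sharpA A T x))" by (intro mult_left_mono B) simp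
    finally show ?thesis using False by (simp add: mult_ac less_le)
  qed (use B in simp)
  then show ?thesis using B(1) by (auto simp: bounded_A_def)
qed

end

end


section \<open>Polynomials of a positive operator\<close>

text \<open>Horner's scheme as in \<open>poly_op\<close>, so that \<open>poly_op\<close> on the completion acts termwise on
  representing sequences.\<close>

definition opoly :: "('h::complex_inner \<Rightarrow> 'h) \<Rightarrow> complex poly \<Rightarrow> 'h \<Rightarrow> 'h" where
  "opoly P p = fold_coeffs (\<lambda>a F x. a *\<^sub>C x + P (F x)) p (\<lambda>_. 0)"

lemma opoly_0 [simp]: "opoly P 0 x = 0"
  by (simp add: opoly_def)

locale positive_bounded_A = positive_operator A for A :: "'h::chilbert_space \<Rightarrow> 'h" +
  fixes P :: "'h \<Rightarrow> 'h" and M :: real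
  assumes P_add: "P (x + y) = P x + P y"
    and P_scale: "P (c *\<^sub>C x) = c *\<^sub>C P x"
    and P_sym: "cinnerA A (P x) y = cinnerA A x (P y)"
    and P_nonneg: "Re (cinnerA A (P x) x) \<ge> 0"
    and M_nonneg: "M \<ge> 0"
    and P_le: "normA A (P x) \<le> M * normA A x"
begin

lemma P_zero [simp]: "P 0 = 0"
  using P_add[of 0 0] by simp

lemma opoly_pCons: "opoly P (pCons a p) x = a *\<^sub>C x + P (opoly P p x)"
  by (cases "p = 0"; cases "a = 0") (simp_all add: opoly_def)

lemma opoly_vec_add: "opoly P p (x + y) = opoly P p x + opoly P p y"
  by (induction p) (simp_all add: opoly_pCons P_add scaleC_add_right algebra_simps)

lemma opoly_vec_scale: "opoly P p (c *\<^sub>C x) = c *\<^sub>C opoly P p x"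
  by (induction p) (simp_all add: opoly_pCons P_scale scaleC_add_right scaleC_scaleC mult.commute)

lemma opoly_add: "opoly P (p + q) x = opoly P p x + opoly P q x"
  by (induction p q rule: poly_induct2) (simp_all add: opoly_pCons P_add scaleC_add_left algebra_simps)

lemma opoly_smult: "opoly P (smult c p) x = c *\<^sub>C opoly P p x"
  by (induction p) (simp_all add: opoly_pCons P_scale scaleC_add_right scaleC_scaleC)

lemma opoly_diff: "opoly P (p - q) x = opoly P p x - opoly P q x"
  using opoly_add[of "p - q" q x] by simp

lemma opoly_mult: "opoly P (p * q) x = opoly P p (opoly P q x)"
  by (induction p) (simp_all add: opoly_pCons mult_pCons_left opoly_add opoly_smult)

lemma opoly_const: "opoly P [:c:] x = c *\<^sub>C x"
  by (simp add: opoly_pCons)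

lemma opoly_one: "opoly P 1 x = x"
  by (simp add: one_pCons opoly_const)

lemma opoly_linear: "opoly P [:a, b:] x = a *\<^sub>C x + b *\<^sub>C P x"
  by (simp add: opoly_pCons P_scale)

lemma opoly_monom: "opoly P (monom 1 n) x = (P ^^ n) x"
  by (induction n) (simp_all add: monom_Suc opoly_pCons opoly_one flip: one_poly_eq_simps)

lemma P_opoly_commute: "P (opoly P p x) = opoly P p (P x)"
  by (induction p) (simp_all add: opoly_pCons P_add P_scale)

lemma opoly_adjoint: "cinnerA A (opoly P p x) y = cinnerA A x (opoly P (map_poly cnj p) y)"
proof (induction p arbitrary: y)
  case (pCons a p)
  then show ?case
    by (simp add: opoly_pCons map_poly_pCons cinnerA_simps P_sym flip: P_opoly_commute)
qed simp

lemma normA_opoly_cnj: "normA A (opoly P (map_poly cnj p) x) = normA A (opoly P p x)"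
proof -
  have "cinnerA A (opoly P p x) (opoly P p x)
      = cinnerA A x (opoly P (map_poly cnj p) (opoly P p x))"
    by (rule opoly_adjoint)
  also have "\<dots> = cinnerA A x (opoly P p (opoly P (map_poly cnj p) x))"
    by (simp add: mult.commute flip: opoly_mult)
  also have "\<dots> = cinnerA A (opoly P (map_poly cnj p) x) (opoly P (map_poly cnj p) x)"
    by (simp add: opoly_adjoint map_poly_map_poly o_def)
  finally show ?thesis by (simp add: normA_def)
qed

lemma opoly_bounded: "\<exists>B\<ge>0. \<forall>x. normA A (opoly P p x) \<le> B * normA A x"
proof (induction p)
  case (pCons a p)
  then obtain B where B: "B \<ge> 0" "\<And>x. normA A (opoly P p x) \<le> B * normA A x" by blast
  have "normA A (opoly P (pCons a p) x) \<le> (cmod a + M * B) * normA A x" for x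
  proof -
    have "normA A (opoly P (pCons a p) x) \<le> cmod a * normA A x + normA A (P (opoly P p x))"
      unfolding opoly_pCons using normA_triangle by (metis normA_scale)
    also have "normA A (P (opoly P p x)) \<le> M * normA A (opoly P p x)" by (rule P_le)
    also have "\<dots> \<le> M * (B * normA A x)" by (intro mult_left_mono B M_nonneg)
    finally show ?thesis by (simp add: algebra_simps)
  qed
  then show ?case using B M_nonneg by (intro exI[of _ "cmod a + M * B"]) simp
qed (auto intro!: exI[of _ 0])

text \<open>The points where this fails form the approximate point spectrum of the operator induced by
  \<open>P\<close> on the completion.\<close>

definition bounded_below_at :: "complex \<Rightarrow> bool" where
  "bounded_below_at t \<longleftrightarrow> (\<exists>c>0. \<forall>x. c * normA A x \<le> normA A (P x - t *\<^sub>C x))"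

lemma cinnerA_P_self: "cinnerA A (P x) x = complex_of_real (Re (cinnerA A (P x) x))"
  using cinnerA_commute[of "P x" x] P_sym[of x x] by (simp add: complex_eq_iff)

lemma bounded_below_atI:
  assumes "c > 0" "\<And>x. c * (normA A x)\<^sup>2 \<le> cmod (cinnerA A (P x - t *\<^sub>C x) x)"
  shows "bounded_below_at t"
  unfolding bounded_below_at_def
proof (intro exI[of _ c] conjI allI)
  fix x
  show "c * normA A x \<le> normA A (P x - t *\<^sub>C x)"
  proof (cases "normA A x = 0")
    case False
    have "c * normA A x * normA A x \<le> normA A (P x - t *\<^sub>C x) * normA A x"
      using assms(2)[of x] Cauchy_Schwarz_A[of "P x - t *\<^sub>C x" x]
      by (simp add: power2_eq_square mult.assoc)
    then show ?thesis using False by (simp add: less_le)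
  qed simp
qed fact

text \<open>Off \<open>[0, M]\<close> one of \<open>\<bar>Im t\<bar>\<close>, \<open>- Re t\<close>, \<open>Re t - M\<close> is positive, and \<open>\<bar>\<langle>(P - t) x, x\<rangle>\<bar>\<close> is at
  least that number times \<open>\<parallel>x\<parallel>\<^sup>2\<close>.\<close>

lemma not_bounded_below_at_imp:
  assumes "\<not> bounded_below_at t"
  obtains s where "0 \<le> s" "s \<le> M" "t = complex_of_real s"
proof -
  have e: "cinnerA A (P x - t *\<^sub>C x) x
      = complex_of_real (Re (cinnerA A (P x) x)) - t * complex_of_real ((normA A x)\<^sup>2)" for x
    by (simp add: cinnerA_simps cinnerA_self) (metis cinnerA_P_self)
  have "Im t = 0"
  proof (rule ccontr)
    assume "Im t \<noteq> 0"
    moreover have "\<bar>Im t\<bar> * (normA A x)\<^sup>2 \<le> cmod (cinnerA A (P x - t *\<^sub>C x) x)" for x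
      using abs_Im_le_cmod[of "cinnerA A (P x - t *\<^sub>C x) x"] by (simp add: e abs_mult)
    ultimately show False using bounded_below_atI[of "\<bar>Im t\<bar>" t] assms by simp
  qed
  moreover have "Re t \<ge> 0"
  proof (rule ccontr)
    assume "\<not> Re t \<ge> 0"
    moreover have "- Re t * (normA A x)\<^sup>2 \<le> cmod (cinnerA A (P x - t *\<^sub>C x) x)" for x
      using complex_Re_le_cmod[of "cinnerA A (P x - t *\<^sub>C x) x"] P_nonneg[of x] by (simp add: e)
    ultimately show False using bounded_below_atI[of "- Re t" t] assms by simp
  qed
  moreover have "Re t \<le> M"
  proof (rule ccontr)
    assume *: "\<not> Re t \<le> M"
    have "(Re t - M) * (normA A x)\<^sup>2 \<le> cmod (cinnerA A (P x - t *\<^sub>C x) x)" for x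
    proof -
      have "Re (cinnerA A (P x) x) \<le> normA A (P x) * normA A x" by (rule Re_cinnerA_le)
      also have "\<dots> \<le> M * normA A x * normA A x" by (intro mult_right_mono P_le) simp
      finally have "(Re t - M) * (normA A x)\<^sup>2 \<le> - Re (cinnerA A (P x - t *\<^sub>C x) x)"
        unfolding e by (simp add: algebra_simps power2_eq_square)
      also have "\<dots> \<le> cmod (cinnerA A (P x - t *\<^sub>C x) x)"
        using abs_Re_le_cmod[of "cinnerA A (P x - t *\<^sub>C x) x"] by linarith
      finally show ?thesis .
    qed
    then show False using bounded_below_atI[of "Re t - M" t] assms * by simp
  qed
  ultimately show ?thesis using that[of "Re t"] by (simp add: complex_eq_iff)
qed

text \<open>A polynomial is a product of linear factors, so \<open>p(P)\<close> is bounded below as soon as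
  \<open>P - t\<close> is so for every root \<open>t\<close> of \<open>p\<close>.\<close>

lemma opoly_bounded_below:
  assumes "p \<noteq> 0" "\<And>t. poly p t = 0 \<Longrightarrow> bounded_below_at t"
  shows "\<exists>c>0. \<forall>x. c * normA A x \<le> normA A (opoly P p x)"
  using assms
proof (induction "degree p" arbitrary: p)
  case 0
  then obtain a where a: "p = [:a:]" using degree_eq_zeroE by metis
  then show ?case using 0 by (intro exI[of _ "cmod a"]) (simp add: opoly_const normA_scale)
next
  case (Suc n)
  then have "\<not> constant (poly p)" by (simp add: constant_degree)
  then obtain z where z: "poly p z = 0" using fundamental_theorem_of_algebra by blast
  then obtain q where q: "p = [:-z, 1:] * q" using poly_eq_0_iff_dvd by blast
  have q0: "q \<noteq> 0" using Suc.prems(1) q by auto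
  then have "degree p = Suc (degree q)" using q degree_mult_eq[of "[:-z, 1:]" q] by simp
  then have "\<exists>c>0. \<forall>x. c * normA A x \<le> normA A (opoly P q x)"
    using Suc q0 by (intro Suc.hyps(1)) (auto simp: q)
  then obtain c where c: "c > 0" "\<And>x. c * normA A x \<le> normA A (opoly P q x)" by blast
  obtain d where d: "d > 0" "\<And>x. d * normA A x \<le> normA A (P x - z *\<^sub>C x)"
    using Suc.prems(2)[OF z] by (auto simp: bounded_below_at_def)
  have "d * c * normA A x \<le> normA A (opoly P p x)" for x
  proof -
    have "d * (c * normA A x) \<le> d * normA A (opoly P q x)" using c d by simp
    also have "\<dots> \<le> normA A (P (opoly P q x) - z *\<^sub>C opoly P q x)" by (rule d)
    also have "\<dots> = normA A (opoly P p x)"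
      by (simp only: q opoly_mult opoly_linear scaleC_minus_left scaleC_one) simp
    finally show ?thesis by (simp add: mult.assoc)
  qed
  then show ?case using c(1) d(1) by (intro exI[of _ "d * c"]) simp
qed

text \<open>With \<open>L\<close> the norm of \<open>p(P)\<close> and \<open>G = p(P)\<^sup>* p(P)\<close>, a sequence of unit vectors with
  \<open>\<parallel>p(P) x\<parallel> \<longlongrightarrow> L\<close> satisfies \<open>\<parallel>(G - L\<^sup>2) x\<parallel>\<^sup>2 \<le> 2 L\<^sup>2 (L\<^sup>2 - \<parallel>p(P) x\<parallel>\<^sup>2) \<longlongrightarrow> 0\<close>.\<close>

lemma normal_minus_norm_not_bounded_below:
  assumes unit: "normA A e = 1"
    and L: "L = Sup {normA A (opoly P p x) | x. normA A x = 1}"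
  shows "\<not> (\<exists>c>0. \<forall>x. c * normA A x
    \<le> normA A (opoly P (map_poly cnj p * p - [:complex_of_real (L\<^sup>2):]) x))"
    and "normA A (opoly P p x) \<le> L * normA A x"
    and "L \<ge> 0"
proof -
  define S where "S = {normA A (opoly P p x) | x. normA A x = 1}"
  obtain B where B: "\<And>x. normA A (opoly P p x) \<le> B * normA A x" using opoly_bounded by blast
  have S: "S \<noteq> {}" "bdd_above S"
    using unit B unfolding S_def by (auto intro!: bdd_aboveI[of _ B]) (metis B mult.right_neutral)
  have L_S: "L = Sup S" by (simp add: L S_def)
  have le_unit: "normA A (opoly P p x) \<le> L" if "normA A x = 1" for x
    unfolding L_S using that S by (intro cSup_upper) (auto simp: S_def)
  show L0: "L \<ge> 0" using le_unit[OF unit] normA_nonneg[of "opoly P p e"] by linarith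
  show le: "normA A (opoly P p x) \<le> L * normA A x" for x
  proof (cases "normA A x = 0")
    case True
    then show ?thesis using B[of x] by simp
  next
    case False
    define c where "c = complex_of_real (1 / normA A x)"
    have c: "cmod c = 1 / normA A x" unfolding c_def norm_of_real by simp
    have "normA A (c *\<^sub>C x) = 1" using False by (simp add: normA_scale c)
    from le_unit[OF this] show ?thesis
      using False by (simp add: opoly_vec_scale normA_scale c less_le field_simps)
  qed
  show "\<not> (\<exists>c>0. \<forall>x. c * normA A x
    \<le> normA A (opoly P (map_poly cnj p * p - [:complex_of_real (L\<^sup>2):]) x))" (is "\<not> (\<exists>c>0. \<forall>x. _ \<le> normA A (opoly P ?g x))")
  proof
    assume "\<exists>c>0. \<forall>x. c * normA A x \<le> normA A (opoly P ?g x)"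
    then obtain c where c: "c > 0" "\<And>x. c * normA A x \<le> normA A (opoly P ?g x)" by blast
    \<comment> \<open>small enough that \<open>4 L\<^sup>3 \<delta> < c\<^sup>2\<close>\<close>
    define \<delta> where "\<delta> = c\<^sup>2 / (4 * L ^ 3 + 1)"
    have \<delta>: "\<delta> > 0" using c L0 by (simp add: \<delta>_def add_nonneg_pos)
    have "\<exists>y\<in>S. Sup S - \<delta> < y" using S \<delta> by (subst less_cSup_iff[symmetric]) auto
    then obtain x where x: "normA A x = 1" "L - \<delta> < normA A (opoly P p x)"
      by (auto simp: S_def L_S)
    define y where "y = opoly P p x"
    define G where "G = opoly P (map_poly cnj p) y"
    have yL: "normA A y \<le> L" using le_unit[OF x(1)] by (simp add: y_def)
    have "normA A G \<le> L * normA A y" unfolding G_def using le[of y] by (simp add: normA_opoly_cnj)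
    also have "\<dots> \<le> L * L" using yL L0 by (intro mult_left_mono)
    finally have G: "(normA A G)\<^sup>2 \<le> (L\<^sup>2)\<^sup>2" by (intro power_mono) (simp_all add: power2_eq_square)
    have Gx: "cinnerA A x G = complex_of_real ((normA A y)\<^sup>2)"
      unfolding G_def opoly_adjoint[symmetric] y_def[symmetric] by (rule cinnerA_self)
    have Gx': "cinnerA A G x = complex_of_real ((normA A y)\<^sup>2)"
      using cinnerA_commute[of G x] by (simp add: Gx)
    have gx: "opoly P ?g x = G - complex_of_real (L\<^sup>2) *\<^sub>C x"
      by (simp add: opoly_diff opoly_mult opoly_const G_def y_def)
    have "(normA A (opoly P ?g x))\<^sup>2 = (normA A G)\<^sup>2 - 2 * L\<^sup>2 * (normA A y)\<^sup>2 + (L\<^sup>2)\<^sup>2"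
      unfolding gx normA_sq[of "G - complex_of_real (L\<^sup>2) *\<^sub>C x"] using x(1)
      by (simp add: cinnerA_simps Gx Gx' cinnerA_self[of G] cinnerA_self[of x] power2_eq_square[of "L\<^sup>2"]
          del: of_real_power) (simp add: algebra_simps)
    also have "\<dots> \<le> 2 * L\<^sup>2 * (L\<^sup>2 - (normA A y)\<^sup>2)" using G by (simp add: algebra_simps power2_eq_square)
    also have "L\<^sup>2 - (normA A y)\<^sup>2 = (L - normA A y) * (L + normA A y)"
      by (simp add: power2_eq_square algebra_simps)
    also have "2 * L\<^sup>2 * ((L - normA A y) * (L + normA A y)) \<le> 2 * L\<^sup>2 * (\<delta> * (2 * L))"
      using x(2) yL L0 \<delta> by (intro mult_left_mono mult_mono) (auto simp: y_def)
    also have "\<dots> = \<delta> * (4 * L ^ 3)" by (simp add: power2_eq_square power3_eq_cube)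
    also have "\<dots> < \<delta> * (4 * L ^ 3 + 1)" using \<delta> by simp
    also have "\<dots> = c\<^sup>2"
    proof -
      have "4 * L ^ 3 + 1 > 0" using L0 by (simp add: add_nonneg_pos)
      then show ?thesis by (simp add: \<delta>_def)
    qed
    finally have "normA A (opoly P ?g x) < c" using c(1) by (simp add: power_less_imp_less_base)
    with c(2)[of x] x(1) show False by simp
  qed
qed

lemma cmod_poly_at_root:
  assumes t: "\<not> bounded_below_at t"
    and root: "poly (map_poly cnj p * p - [:complex_of_real (L\<^sup>2):]) t = 0" and "L \<ge> 0"
  shows "cmod (poly p t) = L"
proof -
  from t obtain s where "t = complex_of_real s" by (rule not_bounded_below_at_imp)
  then have "cnj (poly p t) * poly p t = complex_of_real (L\<^sup>2)" using root by simp
  then have "(cmod (poly p t))\<^sup>2 = L\<^sup>2" by (simp only: cnj_mult_self of_real_eq_iff)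
  then show ?thesis using \<open>L \<ge> 0\<close> by (simp add: power2_eq_iff_nonneg)
qed

lemma norm_attained_at_spectrum:
  assumes unit: "normA A e = 1"
    and L: "L = Sup {normA A (opoly P p x) | x. normA A x = 1}"
    and nz: "map_poly cnj p * p - [:complex_of_real (L\<^sup>2):] \<noteq> 0"
  shows "\<exists>t. \<not> bounded_below_at t \<and> cmod (poly p t) = L"
  using opoly_bounded_below[OF nz] normal_minus_norm_not_bounded_below(1,3)[OF unit L]
    cmod_poly_at_root by blast

text \<open>If \<open>p\<^sup>* p\<close> is the constant \<open>L\<^sup>2\<close> there is no root to find, but then any point of the
  spectrum serves; one exists by the previous lemma for the polynomial \<open>t\<close>.\<close>

lemma spectrum_nonempty:
  assumes unit: "normA A e = 1"
  shows "\<exists>t. \<not> bounded_below_at t"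
proof -
  define p :: "complex poly" where "p = [:0, 1:]"
  define L where "L = Sup {normA A (opoly P p x) | x. normA A x = 1}"
  have "map_poly cnj p * p - [:complex_of_real (L\<^sup>2):] \<noteq> 0"
    by (simp add: p_def map_poly_pCons)
  from norm_attained_at_spectrum[OF unit L_def this] show ?thesis by blast
qed

text \<open>Only the values of \<open>p\<close> on the approximate point spectrum enter.  This makes the functional
  calculus on the completion independent of the approximating polynomials.\<close>

lemma normA_opoly_le:
  assumes "\<And>t. \<not> bounded_below_at t \<Longrightarrow> cmod (poly p t) \<le> \<epsilon>"
  shows "normA A (opoly P p x) \<le> \<epsilon> * normA A x"
proof (cases "normA A x = 0")
  case True
  obtain B where B: "normA A (opoly P p x) \<le> B * normA A x" using opoly_bounded by blast
  with True show ?thesis by simp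
next
  case False
  define c where "c = complex_of_real (1 / normA A x)"
  have "cmod c = 1 / normA A x" unfolding c_def norm_of_real by simp
  then have unit: "normA A (c *\<^sub>C x) = 1" using False by (simp add: normA_scale)
  define L where "L = Sup {normA A (opoly P p x) | x. normA A x = 1}"
  have "\<exists>t. \<not> bounded_below_at t \<and> cmod (poly p t) = L"
  proof (cases "map_poly cnj p * p - [:complex_of_real (L\<^sup>2):] = 0")
    case True
    obtain t where t: "\<not> bounded_below_at t" using spectrum_nonempty[OF unit] by blast
    then have "cmod (poly p t) = L"
      by (rule cmod_poly_at_root)
        (simp_all only: True poly_0 normal_minus_norm_not_bounded_below(3)[OF unit L_def])
    with t show ?thesis by blast
  qed (rule norm_attained_at_spectrum[OF unit L_def])
  then have "L \<le> \<epsilon>" using assms by blast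
  then have "L * normA A x \<le> \<epsilon> * normA A x" by (intro mult_right_mono) simp_all
  with normal_minus_norm_not_bounded_below(2)[OF unit L_def, of x] show ?thesis by linarith
qed

end


section \<open>McCarthy's inequality for polynomial approximations of a power\<close>

text \<open>With \<open>b = c\<^sup>r\<^sup>-\<^sup>1\<close>, Young's inequality for \<open>t b\<close> and the exponents \<open>r\<close>, \<open>r / (r - 1)\<close> is the tangent
  line of \<open>t\<^sup>r\<close> at \<open>c\<close>.\<close>

lemma powr_supporting_line:
  fixes r c :: real
  assumes r: "r \<ge> 1" and c: "c \<ge> 0"
  shows "\<exists>a b. (\<forall>t\<ge>0. a * t + b \<le> t powr r) \<and> a * c + b = c powr r"
proof (cases "c = 0 \<or> r = 1")
  case True
  then show ?thesis
  proof
    assume "c = 0"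
    then show ?thesis by (intro exI[of _ 0]) simp
  next
    assume "r = 1"
    then show ?thesis using c by (intro exI[of _ 1] exI[of _ 0]) simp
  qed
next
  case False
  then have r1: "r > 1" and c0: "c > 0" using r c by auto
  define b where "b = c powr (r - 1)"
  have "t * b * r - (r - 1) * c powr r \<le> t powr r" if t: "t \<ge> 0" for t
  proof -
    have "t * b \<le> t powr r / r + b powr (r / (r - 1)) / (r / (r - 1))"
      by (rule Youngs_inequality) (use r1 t in \<open>auto simp: b_def field_simps\<close>)
    also have "b powr (r / (r - 1)) = c powr r" using r1 by (simp add: b_def powr_powr)
    finally have "t * b * r \<le> (t powr r / r + c powr r / (r / (r - 1))) * r"
      using r1 by (intro mult_right_mono) auto
    also have "\<dots> = t powr r + (r - 1) * c powr r" using r1 by (simp add: field_simps)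
    finally show ?thesis by simp
  qed
  moreover have "c * b = c powr r"
    using c0 by (simp add: b_def powr_diff)
  ultimately show ?thesis
    by (intro exI[of _ "b * r"] exI[of _ "- (r - 1) * c powr r"]) (simp add: algebra_simps)
qed

context positive_bounded_A
begin

text \<open>Let \<open>\<ell>\<close> be the supporting line of \<open>t\<^sup>r\<close> at \<open>c = \<langle>P x, x\<rangle>\<close> and \<open>D\<close> a bound for
  \<open>t\<^sup>r - \<ell>\<close> on \<open>[0, M]\<close>.  Since \<open>0 \<le> t\<^sup>r - \<ell> \<le> D\<close>, the polynomial \<open>q - \<ell> - D\<close> has modulus at most
  \<open>D + \<epsilon>\<close> there, and the spectral bound for its norm says \<open>\<langle>(q - \<ell>)(P) x, x\<rangle> \<ge> - \<epsilon>\<close>, while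
  \<open>\<langle>\<ell>(P) x, x\<rangle> = \<ell>(c) = c\<^sup>r\<close>.\<close>

lemma McCarthy_approximation:
  assumes r: "r \<ge> 1" and x: "normA A x = 1"
    and q: "\<And>t. 0 \<le> t \<Longrightarrow> t \<le> M \<Longrightarrow>
      cmod (poly q (complex_of_real t) - complex_of_real (t powr r)) \<le> \<epsilon>"
  shows "Re (cinnerA A (P x) x) powr r - \<epsilon> \<le> Re (cinnerA A (opoly P q x) x)"
proof -
  define c where "c = Re (cinnerA A (P x) x)"
  obtain a b where ab: "\<And>t. t \<ge> 0 \<Longrightarrow> a * t + b \<le> t powr r" "a * c + b = c powr r"
    using powr_supporting_line[OF r, of c] P_nonneg[of x] by (auto simp: c_def)
  define D where "D = M powr r + \<bar>a\<bar> * M + \<bar>b\<bar>"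
  define p where "p = q - [:complex_of_real (b + D), complex_of_real a:]"
  have "cmod (poly p t) \<le> D + \<epsilon>" if t: "\<not> bounded_below_at t" for t
  proof -
    from t obtain s where s: "0 \<le> s" "s \<le> M" "t = complex_of_real s"
      by (rule not_bounded_below_at_imp)
    have "s powr r \<le> M powr r" using s r by (intro powr_mono2) auto
    moreover have "\<bar>a * s\<bar> \<le> \<bar>a\<bar> * M" using s by (simp add: abs_mult mult_left_mono)
    ultimately have "\<bar>s powr r - (a * s + b) - D\<bar> \<le> D"
      using ab(1)[OF s(1)] by (simp add: D_def)
    then have "cmod (complex_of_real (s powr r - (a * s + b) - D)) \<le> D"
      by (simp only: norm_of_real)
    moreover have "poly p t = complex_of_real (s powr r - (a * s + b) - D)
        + (poly q (complex_of_real s) - complex_of_real (s powr r))"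
      by (simp add: p_def s algebra_simps)
    ultimately show ?thesis
      using q[OF s(1,2)] by (metis norm_triangle_mono)
  qed
  then have "normA A (opoly P p x) \<le> D + \<epsilon>" using normA_opoly_le[of p "D + \<epsilon>" x] x by simp
  then have "- Re (cinnerA A (opoly P p x) x) \<le> D + \<epsilon>"
    using Re_cinnerA_le[of "- opoly P p x" x] x by (simp add: normA_minus cinnerA_minus)
  moreover have "Re (cinnerA A (opoly P p x) x) = Re (cinnerA A (opoly P q x) x) - (a * c + b) - D"
    using x by (simp add: p_def opoly_diff opoly_linear cinnerA_simps cinnerA_self c_def)
  ultimately show ?thesis using ab(2) by (simp add: c_def)
qed

text \<open>For integer exponents the power itself is a polynomial.\<close>

lemma McCarthy_integer:
  assumes "n \<ge> 1" "normA A x = 1"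
  shows "Re (cinnerA A (P x) x) ^ n \<le> Re (cinnerA A ((P ^^ n) x) x)"
proof -
  have "t powr real n = t ^ n" if "t \<ge> 0" for t :: real
    using that assms(1) by (cases "t = 0") (auto simp: powr_realpow)
  moreover from this have "Re (cinnerA A (P x) x) powr real n - 0 \<le> Re (cinnerA A (opoly P (monom 1 n) x) x)"
    using assms by (intro McCarthy_approximation) (auto simp: poly_monom)
  ultimately show ?thesis using P_nonneg[of x] by (simp add: opoly_monom)
qed

end


section \<open>Polynomial approximation\<close>

lemma complex_polynomial_approximation:
  fixes f :: "real \<Rightarrow> complex"
  assumes f: "continuous_on {a..b} f" and e: "e > 0"
  shows "\<exists>p. \<forall>t\<in>{a..b}. cmod (poly p (complex_of_real t) - f t) < e"
proof -
  have real_case: "\<exists>p. \<forall>t\<in>{a..b}. cmod (poly p (complex_of_real t) - complex_of_real (g t)) < e / 2"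
    if g: "continuous_on {a..b} g" for g :: "real \<Rightarrow> real"
  proof -
    obtain h where h: "real_polynomial_function h" "\<And>t. t \<in> {a..b} \<Longrightarrow> \<bar>g t - h t\<bar> < e / 2"
      using Stone_Weierstrass_real_polynomial_function[OF compact_Icc g, of "e / 2"] e by auto
    obtain c n where c: "h = (\<lambda>x. \<Sum>i\<le>n. c i * x ^ i)"
      using h(1) real_polynomial_function_iff_sum by auto
    define p where "p = (\<Sum>i\<le>n. monom (complex_of_real (c i)) i)"
    have "poly p (complex_of_real t) - complex_of_real (g t) = complex_of_real (h t - g t)" for t
      by (simp add: p_def c poly_sum poly_monom)
    then show ?thesis
      using h(2) by (intro exI[of _ p]) (simp add: abs_minus_commute del: of_real_diff)
  qed
  obtain p q where
    p: "\<forall>t\<in>{a..b}. cmod (poly p (complex_of_real t) - complex_of_real (Re (f t))) < e / 2" and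
    q: "\<forall>t\<in>{a..b}. cmod (poly q (complex_of_real t) - complex_of_real (Im (f t))) < e / 2"
    using real_case[of "\<lambda>t. Re (f t)"] real_case[of "\<lambda>t. Im (f t)"] f
    by (auto intro: continuous_on_Re continuous_on_Im)
  have "cmod (poly (p + smult \<i> q) (complex_of_real t) - f t) < e" if t: "t \<in> {a..b}" for t
  proof -
    have "poly (p + smult \<i> q) (complex_of_real t) - f t
        = (poly p t - complex_of_real (Re (f t))) + \<i> * (poly q t - complex_of_real (Im (f t)))"
      by (subst (1) complex_eq[of "f t"]) (simp add: algebra_simps)
    also have "cmod \<dots> \<le> cmod (poly p t - complex_of_real (Re (f t)))
        + cmod (poly q t - complex_of_real (Im (f t)))"
      by (rule order_trans[OF norm_triangle_ineq]) (simp add: norm_mult)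
    also have "\<dots> < e" using p q t by fastforce
    finally show ?thesis .
  qed
  then show ?thesis by blast
qed

lemma complex_polynomial_sequence:
  fixes f :: "real \<Rightarrow> complex"
  assumes f: "continuous_on {a..b} f"
  shows "\<exists>p. \<forall>n. \<forall>t\<in>{a..b}. cmod (poly (p n) (complex_of_real t) - f t) \<le> 1 / Suc n"
proof -
  have "\<forall>n. \<exists>p. \<forall>t\<in>{a..b}. cmod (poly p (complex_of_real t) - f t) \<le> 1 / Suc n"
  proof
    fix n
    have "1 / real (Suc n) > 0" by simp
    from complex_polynomial_approximation[OF f this]
    obtain p where "\<forall>t\<in>{a..b}. cmod (poly p (complex_of_real t) - f t) < 1 / Suc n" by blast
    then show "\<exists>p. \<forall>t\<in>{a..b}. cmod (poly p (complex_of_real t) - f t) \<le> 1 / Suc n"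
      by (intro exI[of _ p]) (simp add: less_imp_le)
  qed
  then show ?thesis by (rule choice)
qed


section \<open>The completion and operators given by sequences\<close>

text \<open>A point of the completion is a class of Cauchy sequences, so an operator on the completion
  can be given by a sequence of operators on the original space, applied termwise.\<close>

definition limit_op ::
  "('h::complex_inner \<Rightarrow> 'h) \<Rightarrow> (nat \<Rightarrow> 'h \<Rightarrow> 'h) \<Rightarrow> (nat \<Rightarrow> 'h) set \<Rightarrow> (nat \<Rightarrow> 'h) set" where
  "limit_op A F U = (\<Union>X\<in>U. eqA A `` {\<lambda>n. F n (X n)})"

lemma tendsto_0_le:
  fixes f g :: "nat \<Rightarrow> real"
  assumes "\<And>n. 0 \<le> f n" "\<And>n. f n \<le> g n" "g \<longlonglongrightarrow> 0"
  shows "f \<longlonglongrightarrow> 0"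
  using assms by (intro tendsto_sandwich[OF _ _ tendsto_const[of 0] assms(3)]) simp_all

lemma bounded_ops_bound:
  "F \<in> bounded_ops K \<Longrightarrow> \<exists>b. \<forall>u\<in>pts K. nrm K (F u) \<le> b * nrm K u"
  by (simp add: bounded_ops_def)

lemma bounded_ops_pts: "F \<in> bounded_ops K \<Longrightarrow> u \<in> pts K \<Longrightarrow> F u \<in> pts K"
  by (auto simp: bounded_ops_def)

context positive_operator
begin

abbreviation (input) K where "K \<equiv> completionA A"

definition cls :: "(nat \<Rightarrow> 'h) \<Rightarrow> (nat \<Rightarrow> 'h) set" where
  "cls X = eqA A `` {X}"

text \<open>Being Cauchy uniformly on seminorm-bounded sets is what makes the diagonal \<open>n \<mapsto> F n (X n)\<close> of a
  Cauchy sequence \<open>X\<close> again Cauchy.\<close>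

definition op_Cauchy :: "(nat \<Rightarrow> 'h \<Rightarrow> 'h) \<Rightarrow> bool" where
  "op_Cauchy F \<longleftrightarrow>
     (\<forall>n x y. F n (x + y) = F n x + F n y) \<and> (\<forall>n c x. F n (c *\<^sub>C x) = c *\<^sub>C F n x)
     \<and> (\<exists>B\<ge>0. \<forall>n x. normA A (F n x) \<le> B * normA A x)
     \<and> (\<forall>e>0. \<exists>N. \<forall>m\<ge>N. \<forall>n\<ge>N. \<forall>x. normA A (F m x - F n x) \<le> e * normA A x)"

lemma CauchyA_I:
  assumes "\<And>e. e > 0 \<Longrightarrow> \<exists>N. \<forall>m\<ge>N. \<forall>n\<ge>N. normA A (X m - X n) < e"
  shows "X \<in> CauchyA A"
  using assms by (simp add: CauchyA_def)

lemma CauchyA_D: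
  assumes "X \<in> CauchyA A" "e > 0"
  shows "\<exists>N. \<forall>m\<ge>N. \<forall>n\<ge>N. normA A (X m - X n) < e"
  using assms by (simp add: CauchyA_def)

lemma CauchyA_const: "(\<lambda>_. x) \<in> CauchyA A"
  by (simp add: CauchyA_def)

lemma CauchyA_add:
  assumes "X \<in> CauchyA A" "Y \<in> CauchyA A"
  shows "(\<lambda>n. X n + Y n) \<in> CauchyA A"
proof (rule CauchyA_I)
  fix e :: real assume "e > 0"
  then have e2: "e / 2 > 0" by simp
  obtain N1 where N1: "\<forall>m\<ge>N1. \<forall>n\<ge>N1. normA A (X m - X n) < e / 2"
    using CauchyA_D[OF assms(1) e2] by blast
  obtain N2 where N2: "\<forall>m\<ge>N2. \<forall>n\<ge>N2. normA A (Y m - Y n) < e / 2"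
    using CauchyA_D[OF assms(2) e2] by blast
  show "\<exists>N. \<forall>m\<ge>N. \<forall>n\<ge>N. normA A (X m + Y m - (X n + Y n)) < e"
  proof (intro exI[of _ "max N1 N2"] allI impI)
    fix m n assume mn: "max N1 N2 \<le> m" "max N1 N2 \<le> n"
    have "normA A (X m + Y m - (X n + Y n)) \<le> normA A (X m - X n) + normA A (Y m - Y n)"
      using normA_triangle[of "X m - X n" "Y m - Y n"] by (simp add: algebra_simps)
    moreover have "normA A (X m - X n) < e / 2" "normA A (Y m - Y n) < e / 2"
      using N1 N2 mn by simp_all
    ultimately show "normA A (X m + Y m - (X n + Y n)) < e" by linarith
  qed
qed

lemma normA_convergent:
  assumes "X \<in> CauchyA A"
  shows "convergent (\<lambda>n. normA A (X n))"
proof (rule real_Cauchy_convergent, rule metric_CauchyI)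
  fix e :: real assume "e > 0"
  then obtain N where N: "\<forall>m\<ge>N. \<forall>n\<ge>N. normA A (X m - X n) < e"
    using CauchyA_D[OF assms] by blast
  have "dist (normA A (X m)) (normA A (X n)) < e" if "m \<ge> N" "n \<ge> N" for m n
    using N that abs_normA_diff_le[of "X m" "X n"] by (force simp: dist_real_def)
  then show "\<exists>M. \<forall>m\<ge>M. \<forall>n\<ge>M. dist (normA A (X m)) (normA A (X n)) < e" by blast
qed

lemma op_Cauchy_diff:
  assumes "op_Cauchy F"
  shows "F n (x - y) = F n x - F n y"
proof -
  have "F n (x - y + y) = F n (x - y) + F n y" using assms unfolding op_Cauchy_def by blast
  then show ?thesis by simp
qed

lemma CauchyA_op:
  assumes F: "op_Cauchy F" and X: "X \<in> CauchyA A"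
  shows "(\<lambda>n. F n (X n)) \<in> CauchyA A"
proof (rule CauchyA_I)
  fix e :: real assume e: "e > 0"
  obtain B where B: "B \<ge> 0" "\<And>n x. normA A (F n x) \<le> B * normA A x"
    using F by (auto simp: op_Cauchy_def)
  note F_diff = op_Cauchy_diff[OF F]
  obtain L where "(\<lambda>n. normA A (X n)) \<longlonglongrightarrow> L" using normA_convergent[OF X] convergent_def by blast
  then have "Bseq (\<lambda>n. normA A (X n))" using Bseq_conv_Bfun convergentI convergent_imp_Bseq by blast
  then obtain C where C: "C > 0" "\<And>n. normA A (X n) \<le> C"
    unfolding Bseq_def by auto
  have e': "e / (2 * (B + 1)) > 0" "e / (2 * C) > 0" using e B C by simp_all
  obtain N1 where N1: "\<forall>m\<ge>N1. \<forall>n\<ge>N1. normA A (X m - X n) < e / (2 * (B + 1))"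
    using CauchyA_D[OF X e'(1)] by blast
  obtain N2 where N2: "\<forall>m\<ge>N2. \<forall>n\<ge>N2. \<forall>x. normA A (F m x - F n x) \<le> e / (2 * C) * normA A x"
    using F e'(2) unfolding op_Cauchy_def by blast
  show "\<exists>N. \<forall>m\<ge>N. \<forall>n\<ge>N. normA A (F m (X m) - F n (X n)) < e"
  proof (intro exI[of _ "max N1 N2"] allI impI)
    fix m n assume mn: "max N1 N2 \<le> m" "max N1 N2 \<le> n"
    have "normA A (F m (X m) - F m (X n)) \<le> B * normA A (X m - X n)"
      using B(2)[of m "X m - X n"] by (simp add: F_diff)
    also have "\<dots> \<le> B * (e / (2 * (B + 1)))"
      using N1 mn B(1) by (intro mult_left_mono[OF less_imp_le]) simp_all
    also have "\<dots> < (B + 1) * (e / (2 * (B + 1)))"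
      by (rule mult_strict_right_mono) (use e' in simp_all)
    also have "\<dots> = e / 2" using B(1) by (simp add: divide_simps)
    finally have 1: "normA A (F m (X m) - F m (X n)) < e / 2" .
    have "normA A (F m (X n) - F n (X n)) \<le> e / (2 * C) * normA A (X n)" using N2 mn by simp
    also have "\<dots> \<le> e / (2 * C) * C" using C(2) e'(2) by (intro mult_left_mono) simp_all
    also have "\<dots> = e / 2" using C(1) by simp
    finally have 2: "normA A (F m (X n) - F n (X n)) \<le> e / 2" .
    show "normA A (F m (X m) - F n (X n)) < e"
      using normA_triangle_diff[of "F m (X m)" "F n (X n)" "F m (X n)"] 1 2 by linarith
  qed
qed

lemma eqA_sym:
  assumes "(X, Y) \<in> eqA A"
  shows "(Y, X) \<in> eqA A"
proof -
  have "(\<lambda>n. normA A (Y n - X n)) = (\<lambda>n. normA A (X n - Y n))"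
    by (rule ext) (rule normA_minus_commute)
  with assms show ?thesis by (simp add: eqA_def)
qed

lemma equiv_eqA: "equiv (CauchyA A) (eqA A)"
proof (rule equivI)
  show "refl_on (CauchyA A) (eqA A)" by (rule refl_onI) (auto simp: eqA_def)
  show "sym (eqA A)" by (rule symI) (rule eqA_sym)
  show "eqA A \<subseteq> CauchyA A \<times> CauchyA A" by (auto simp: eqA_def)
  show "trans (eqA A)"
  proof (rule transI)
    fix X Y Z assume XY: "(X, Y) \<in> eqA A" and YZ: "(Y, Z) \<in> eqA A"
    have "(\<lambda>n. normA A (X n - Y n) + normA A (Y n - Z n)) \<longlonglongrightarrow> 0 + 0"
      using XY YZ by (intro tendsto_add) (simp_all add: eqA_def)
    then have "(\<lambda>n. normA A (X n - Z n)) \<longlonglongrightarrow> 0"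
      by (intro tendsto_0_le[of "\<lambda>n. normA A (X n - Z n)"
            "\<lambda>n. normA A (X n - Y n) + normA A (Y n - Z n)"])
        (simp_all add: normA_triangle_diff)
    then show "(X, Z) \<in> eqA A" using XY YZ by (simp add: eqA_def)
  qed
qed

lemma cls_eq_iff:
  assumes "X \<in> CauchyA A" "Y \<in> CauchyA A"
  shows "cls X = cls Y \<longleftrightarrow> (\<lambda>n. normA A (X n - Y n)) \<longlonglongrightarrow> 0"
  unfolding cls_def using eq_equiv_class_iff[OF equiv_eqA assms] assms by (simp add: eqA_def)

lemma pts_eq: "pts K = {cls X | X. X \<in> CauchyA A}"
  by (auto simp: completionA_def quotient_def cls_def)

lemma cls_in_pts: "X \<in> CauchyA A \<Longrightarrow> cls X \<in> pts K"
  by (auto simp: pts_eq)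

lemma mem_cls_iff: "Y \<in> cls X \<longleftrightarrow> X \<in> CauchyA A \<and> Y \<in> CauchyA A \<and> (\<lambda>n. normA A (X n - Y n)) \<longlonglongrightarrow> 0"
  by (simp add: cls_def eqA_def)

lemma add_cls:
  assumes "X \<in> CauchyA A" "Y \<in> CauchyA A"
  shows "add K (cls X) (cls Y) = cls (\<lambda>n. X n + Y n)"
proof -
  have "congruent2 (eqA A) (eqA A) (\<lambda>X Y. eqA A `` {\<lambda>n. X n + Y n})"
  proof (rule congruent2I')
    fix X1 X2 Y1 Y2 assume *: "(X1, X2) \<in> eqA A" "(Y1, Y2) \<in> eqA A"
    have "(\<lambda>n. normA A (X1 n - X2 n) + normA A (Y1 n - Y2 n)) \<longlonglongrightarrow> 0 + 0"
      using * by (intro tendsto_add) (simp_all add: eqA_def)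
    then have "(\<lambda>n. normA A (X1 n + Y1 n - (X2 n + Y2 n))) \<longlonglongrightarrow> 0"
    proof (intro tendsto_0_le[of "\<lambda>n. normA A (X1 n + Y1 n - (X2 n + Y2 n))"
          "\<lambda>n. normA A (X1 n - X2 n) + normA A (Y1 n - Y2 n)"])
      show "normA A (X1 n + Y1 n - (X2 n + Y2 n)) \<le> normA A (X1 n - X2 n) + normA A (Y1 n - Y2 n)" for n
        using normA_triangle[of "X1 n - X2 n" "Y1 n - Y2 n"] by (simp add: algebra_simps)
    qed simp_all
    then show "eqA A `` {\<lambda>n. X1 n + Y1 n} = eqA A `` {\<lambda>n. X2 n + Y2 n}"
      using * cls_eq_iff[of "\<lambda>n. X1 n + Y1 n" "\<lambda>n. X2 n + Y2 n"]
      by (simp add: cls_def CauchyA_add eqA_def)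
  qed
  from UN_equiv_class2[OF equiv_eqA equiv_eqA this assms] show ?thesis
    by (simp add: completionA_def cls_def)
qed

lemma op_Cauchy_scale: "op_Cauchy (\<lambda>_ x. c *\<^sub>C x)"
  unfolding op_Cauchy_def
  by (auto simp: scaleC_add_right scaleC_scaleC mult.commute normA_scale intro!: exI[of _ "cmod c"])

lemma limit_op_cls:
  assumes F: "op_Cauchy F" and X: "X \<in> CauchyA A"
  shows "limit_op A F (cls X) = cls (\<lambda>n. F n (X n))"
proof -
  obtain B where B: "B \<ge> 0" "\<And>n x. normA A (F n x) \<le> B * normA A x"
    using F by (auto simp: op_Cauchy_def)
  note F_diff = op_Cauchy_diff[OF F]
  have "congruent (eqA A) (\<lambda>X. eqA A `` {\<lambda>n. F n (X n)})"
  proof (rule congruentI)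
    fix X Y assume XY: "(X, Y) \<in> eqA A"
    have "(\<lambda>n. B * normA A (X n - Y n)) \<longlonglongrightarrow> B * 0"
      using XY by (intro tendsto_mult tendsto_const) (simp add: eqA_def)
    then have "(\<lambda>n. normA A (F n (X n) - F n (Y n))) \<longlonglongrightarrow> 0"
      using B(2) by (intro tendsto_0_le[of "\<lambda>n. normA A (F n (X n) - F n (Y n))"
          "\<lambda>n. B * normA A (X n - Y n)"]) (simp_all flip: F_diff)
    then show "eqA A `` {\<lambda>n. F n (X n)} = eqA A `` {\<lambda>n. F n (Y n)}"
      using XY cls_eq_iff[of "\<lambda>n. F n (X n)" "\<lambda>n. F n (Y n)"]
      by (simp add: cls_def CauchyA_op[OF F] eqA_def)
  qed
  from UN_equiv_class[OF equiv_eqA this X] show ?thesis by (simp add: limit_op_def cls_def)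
qed

lemma scale_cls:
  assumes "X \<in> CauchyA A"
  shows "scale K c (cls X) = cls (\<lambda>n. c *\<^sub>C X n)"
  using limit_op_cls[OF op_Cauchy_scale assms] by (simp add: completionA_def limit_op_def)

lemma CauchyA_scale:
  assumes "X \<in> CauchyA A"
  shows "(\<lambda>n. c *\<^sub>C X n) \<in> CauchyA A"
  using CauchyA_op[OF op_Cauchy_scale assms] .

lemma CauchyA_diff:
  assumes "X \<in> CauchyA A" "Y \<in> CauchyA A"
  shows "(\<lambda>n. X n - Y n) \<in> CauchyA A"
  using CauchyA_add[OF assms(1) CauchyA_scale[OF assms(2), of "-1"]] by simp

lemma op_diff_cls:
  assumes "F U = cls X" "G U = cls Y" "X \<in> CauchyA A" "Y \<in> CauchyA A"
  shows "op_diff K F G U = cls (\<lambda>n. X n - Y n)"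
  using assms add_cls[OF assms(3) CauchyA_scale[OF assms(4), of "-1"]]
  by (simp add: op_diff_def op_add_def op_scale_def scale_cls)

lemma ip_cls:
  assumes X: "X \<in> CauchyA A" and l: "(\<lambda>n. normA A (X n)) \<longlonglongrightarrow> l"
  shows "ip K (cls X) (cls X) = complex_of_real (l\<^sup>2)"
proof -
  have lim: "(\<lambda>n. cinnerA A (Y n) (Z n)) \<longlonglongrightarrow> complex_of_real (l\<^sup>2)"
    if Y: "Y \<in> cls X" and Z: "Z \<in> cls X" for Y Z
  proof -
    obtain k where k: "(\<lambda>n. normA A (Z n)) \<longlonglongrightarrow> k"
      using normA_convergent Z convergent_def by (metis mem_cls_iff)
    have XY: "(\<lambda>n. normA A (X n - Y n)) \<longlonglongrightarrow> 0" "(\<lambda>n. normA A (X n - Z n)) \<longlonglongrightarrow> 0"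
      using Y Z by (simp_all add: mem_cls_iff)
    have "(\<lambda>n. normA A (X n - Y n) * normA A (Z n) + normA A (X n) * normA A (X n - Z n))
        \<longlonglongrightarrow> 0 * k + l * 0"
      by (intro tendsto_intros XY k l)
    then have "(\<lambda>n. cmod (cinnerA A (Y n) (Z n) - cinnerA A (X n) (X n))) \<longlonglongrightarrow> 0"
    proof (intro tendsto_0_le[of "\<lambda>n. cmod (cinnerA A (Y n) (Z n) - cinnerA A (X n) (X n))"
        "\<lambda>n. normA A (X n - Y n) * normA A (Z n) + normA A (X n) * normA A (X n - Z n)"])
      fix n
      have "cinnerA A (Y n) (Z n) - cinnerA A (X n) (X n)
          = cinnerA A (Y n - X n) (Z n) + cinnerA A (X n) (Z n - X n)"
        by (simp add: cinnerA_simps)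
      also have "cmod \<dots> \<le> cmod (cinnerA A (Y n - X n) (Z n)) + cmod (cinnerA A (X n) (Z n - X n))"
        by (rule norm_triangle_ineq)
      also have "\<dots> \<le> normA A (Y n - X n) * normA A (Z n) + normA A (X n) * normA A (Z n - X n)"
        by (intro add_mono Cauchy_Schwarz_A)
      finally show "cmod (cinnerA A (Y n) (Z n) - cinnerA A (X n) (X n))
          \<le> normA A (X n - Y n) * normA A (Z n) + normA A (X n) * normA A (X n - Z n)"
        by (simp add: normA_minus_commute[of "Y n"] normA_minus_commute[of "Z n"])
    qed simp_all
    then have "(\<lambda>n. cinnerA A (Y n) (Z n) - cinnerA A (X n) (X n)) \<longlonglongrightarrow> 0"
      by (simp add: tendsto_norm_zero_iff)
    moreover have "(\<lambda>n. cinnerA A (X n) (X n)) \<longlonglongrightarrow> complex_of_real (l\<^sup>2)"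
      unfolding cinnerA_self by (intro tendsto_intros l)
    ultimately have "(\<lambda>n. cinnerA A (Y n) (Z n) - cinnerA A (X n) (X n) + cinnerA A (X n) (X n))
        \<longlonglongrightarrow> 0 + complex_of_real (l\<^sup>2)"
      by (rule tendsto_add)
    then show ?thesis by simp
  qed
  have "X \<in> cls X" using X by (simp add: mem_cls_iff)
  then show ?thesis
    unfolding completionA_def using lim
    by (simp, intro the_equality) (blast, blast intro: LIMSEQ_unique)
qed

lemma nrm_cls:
  assumes X: "X \<in> CauchyA A"
  shows "(\<lambda>n. normA A (X n)) \<longlonglongrightarrow> nrm K (cls X)"
proof -
  obtain l where l: "(\<lambda>n. normA A (X n)) \<longlonglongrightarrow> l" using normA_convergent[OF X] convergent_def by blast
  have "l \<ge> 0" by (rule LIMSEQ_le_const[OF l]) simp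
  then have "nrm K (cls X) = l" by (simp add: nrm_def ip_cls[OF X l])
  with l show ?thesis by simp
qed

lemma nrm_cls_le:
  assumes "X \<in> CauchyA A" "Y \<in> CauchyA A" "\<And>n. n \<ge> N \<Longrightarrow> normA A (X n) \<le> c * normA A (Y n)"
  shows "nrm K (cls X) \<le> c * nrm K (cls Y)"
  using assms(3)
  by (intro LIMSEQ_le[OF nrm_cls[OF assms(1)] tendsto_mult[OF tendsto_const nrm_cls[OF assms(2)]]]) blast

lemma nrm_cls_const: "nrm K (cls (\<lambda>_. x)) = normA A x"
  using nrm_cls[OF CauchyA_const] by (rule LIMSEQ_unique) (rule tendsto_const)

lemma limit_op_bounded:
  assumes F: "op_Cauchy F"
  shows "limit_op A F \<in> bounded_ops K"
proof -
  obtain B where B: "\<And>n x. normA A (F n x) \<le> B * normA A x"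
    using F by (auto simp: op_Cauchy_def)
  have lin: "F n (x + y) = F n x + F n y" "F n (c *\<^sub>C x) = c *\<^sub>C F n x" for n x y c
    using F unfolding op_Cauchy_def by blast+
  have "nrm K (limit_op A F (cls X)) \<le> B * nrm K (cls X)" if X: "X \<in> CauchyA A" for X
    unfolding limit_op_cls[OF F X] by (rule nrm_cls_le[OF CauchyA_op[OF F X] X B])
  then show ?thesis
    unfolding bounded_ops_def
    by (auto simp: pts_eq limit_op_cls[OF F] add_cls scale_cls CauchyA_add CauchyA_scale
        CauchyA_op[OF F] lin intro!: exI[of _ B])
qed

lemma op_norm_leI:
  assumes "c \<ge> 0" "\<And>X. X \<in> CauchyA A \<Longrightarrow> nrm K (cls X) = 1 \<Longrightarrow> nrm K (F (cls X)) \<le> c"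
  shows "op_norm K F \<le> c"
  unfolding op_norm_def using assms by (intro cSup_least) (auto simp: pts_eq)

lemma bdd_above_op_norm:
  assumes B: "\<And>v. v \<in> pts K \<Longrightarrow> nrm K (F v) \<le> B * nrm K v"
  shows "bdd_above (insert 0 {nrm K (F v) | v. v \<in> pts K \<and> nrm K v = 1})"
  using B by (intro bdd_aboveI[of _ "max 0 B"]) (auto, metis mult.right_neutral max.coboundedI2)

lemma le_op_norm:
  assumes u: "u \<in> pts K" "nrm K u = 1" and B: "\<And>v. v \<in> pts K \<Longrightarrow> nrm K (F v) \<le> B * nrm K v"
  shows "nrm K (F u) \<le> op_norm K F"
  unfolding op_norm_def using u bdd_above_op_norm[OF B] by (intro cSup_upper) auto

lemma op_norm_nonneg:
  assumes B: "\<And>v. v \<in> pts K \<Longrightarrow> nrm K (F v) \<le> B * nrm K v"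
  shows "op_norm K F \<ge> 0"
  unfolding op_norm_def using bdd_above_op_norm[OF B] by (intro cSup_upper) auto

lemma nrm_op_add_le:
  assumes u: "u \<in> pts K" and "F u \<in> pts K" "G u \<in> pts K"
    and "nrm K (F u) \<le> a * nrm K u" "nrm K (G u) \<le> b * nrm K u"
  shows "nrm K (op_add K F G u) \<le> (a + b) * nrm K u"
proof -
  obtain X Y where XY: "X \<in> CauchyA A" "F u = cls X" "Y \<in> CauchyA A" "G u = cls Y"
    using assms by (auto simp: pts_eq)
  have "nrm K (cls (\<lambda>n. X n + Y n)) \<le> nrm K (cls X) + nrm K (cls Y)"
    using normA_triangle
    by (intro LIMSEQ_le[OF nrm_cls[OF CauchyA_add] tendsto_add[OF nrm_cls nrm_cls]] XY) blast
  then show ?thesis using assms XY by (simp add: op_add_def add_cls algebra_simps)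
qed

lemma nrm_op_diff_le:
  assumes u: "u \<in> pts K" and "F u \<in> pts K" "G u \<in> pts K"
    and "nrm K (F u) \<le> a * nrm K u" "nrm K (G u) \<le> b * nrm K u"
  shows "nrm K (op_diff K F G u) \<le> (a + b) * nrm K u"
  unfolding op_diff_def
proof (rule nrm_op_add_le)
  obtain Y where Y: "Y \<in> CauchyA A" "G u = cls Y" using assms by (auto simp: pts_eq)
  show "op_scale K (-1) G u \<in> pts K"
    using Y CauchyA_scale[OF Y(1), of "-1"] by (simp add: op_scale_def scale_cls cls_in_pts)
  have "nrm K (op_scale K (-1) G u) \<le> 1 * nrm K (cls Y)"
    unfolding op_scale_def Y scale_cls[OF Y(1)]
    by (rule nrm_cls_le[OF CauchyA_scale[OF Y(1)] Y(1)]) (simp only: normA_scale norm_minus_cancel norm_one)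
  then show "nrm K (op_scale K (-1) G u) \<le> b * nrm K u" using assms(5) Y by simp
qed (use assms in simp_all)

end


section \<open>Spectrum and functional calculus on the completion\<close>

context positive_bounded_A
begin

abbreviation (input) S where "S \<equiv> induced_op A P"

lemma op_Cauchy_opoly: "op_Cauchy (\<lambda>_. opoly P p)"
  unfolding op_Cauchy_def using opoly_bounded[of p]
  by (simp add: opoly_vec_add opoly_vec_scale)

lemma induced_op_cls:
  assumes "X \<in> CauchyA A"
  shows "S (cls X) = cls (\<lambda>n. P (X n))" "(\<lambda>n. P (X n)) \<in> CauchyA A"
  using limit_op_cls[OF op_Cauchy_opoly assms, of "[:0, 1:]"]
    CauchyA_op[OF op_Cauchy_opoly assms, of "[:0, 1:]"]
  by (simp_all add: opoly_linear limit_op_def induced_op_def)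

lemma CauchyA_opoly:
  assumes "X \<in> CauchyA A"
  shows "(\<lambda>n. opoly P p (X n)) \<in> CauchyA A"
  using CauchyA_op[OF op_Cauchy_opoly assms] .

lemma poly_op_cls:
  assumes X: "X \<in> CauchyA A"
  shows "poly_op K p S (cls X) = cls (\<lambda>n. opoly P p (X n))"
proof (induction p)
  case 0
  then show ?case by (simp add: poly_op_def op_scale_def scale_cls X)
next
  case (pCons a p)
  then have "poly_op K (pCons a p) S = op_add K (op_scale K a id) (S \<circ> poly_op K p S)"
    by (cases "p = 0") (simp_all add: poly_op_def)
  then show ?case
    using pCons.IH X
    by (simp add: op_add_def op_scale_def scale_cls induced_op_cls CauchyA_opoly CauchyA_scale
        add_cls opoly_pCons)
qed

lemma shift_cls:
  assumes X: "X \<in> CauchyA A"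
  shows "op_diff K S (op_scale K t id) (cls X) = cls (\<lambda>n. P (X n) - t *\<^sub>C X n)"
    and "(\<lambda>n. P (X n) - t *\<^sub>C X n) \<in> CauchyA A"
proof -
  have "op_scale K t id (cls X) = cls (\<lambda>n. t *\<^sub>C X n)" using X by (simp add: op_scale_def scale_cls)
  then show "op_diff K S (op_scale K t id) (cls X) = cls (\<lambda>n. P (X n) - t *\<^sub>C X n)"
    using induced_op_cls[OF X] CauchyA_scale[OF X] by (intro op_diff_cls)
  show "(\<lambda>n. P (X n) - t *\<^sub>C X n) \<in> CauchyA A"
    by (rule CauchyA_diff[OF induced_op_cls(2)[OF X] CauchyA_scale[OF X]])
qed

text \<open>A bounded inverse of \<open>S - t\<close> on the completion, tested on constant sequences, bounds \<open>P - t\<close>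
  below on the original space.\<close>

lemma in_spectrum_if_not_bounded_below:
  assumes "\<not> bounded_below_at t"
  shows "t \<in> spectrum K S"
proof (rule ccontr)
  assume "t \<notin> spectrum K S"
  then obtain R where R: "R \<in> bounded_ops K"
    "\<And>u. u \<in> pts K \<Longrightarrow> R (op_diff K S (op_scale K t id) u) = u"
    unfolding spectrum_def by blast
  obtain b where b: "\<And>u. u \<in> pts K \<Longrightarrow> nrm K (R u) \<le> b * nrm K u"
    using bounded_ops_bound[OF R(1)] by blast
  have le: "normA A x \<le> b * normA A (P x - t *\<^sub>C x)" for x
    using R(2)[OF cls_in_pts[OF CauchyA_const[of x]]]
      b[OF cls_in_pts[OF CauchyA_const[of "P x - t *\<^sub>C x"]]]
    by (simp add: shift_cls[OF CauchyA_const] nrm_cls_const)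
  have "1 / (\<bar>b\<bar> + 1) * normA A x \<le> normA A (P x - t *\<^sub>C x)" for x
  proof -
    have "normA A x \<le> (\<bar>b\<bar> + 1) * normA A (P x - t *\<^sub>C x)"
      by (rule order_trans[OF le]) (intro mult_right_mono; simp)
    then show ?thesis by (simp add: divide_simps mult.commute)
  qed
  then have "bounded_below_at t"
    unfolding bounded_below_at_def by (intro exI[of _ "1 / (\<bar>b\<bar> + 1)"]) simp
  with assms show False by blast
qed

lemma normA_opoly_le_interval:
  assumes "\<And>s. 0 \<le> s \<Longrightarrow> s \<le> M \<Longrightarrow> cmod (poly p (complex_of_real s)) \<le> \<epsilon>"
  shows "normA A (opoly P p x) \<le> \<epsilon> * normA A x"
  using assms by (intro normA_opoly_le) (metis not_bounded_below_at_imp)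

context
  fixes p :: "nat \<Rightarrow> complex poly" and f :: "real \<Rightarrow> complex"
  assumes p: "\<forall>n. \<forall>s\<in>{0..M}. cmod (poly (p n) (complex_of_real s) - f s) \<le> 1 / Suc n"
begin

lemma approximants_close:
  "normA A (opoly P (p m) x - opoly P (p n) x) \<le> (1 / Suc m + 1 / Suc n) * normA A x"
  unfolding opoly_diff[symmetric]
proof (rule normA_opoly_le_interval)
  fix s assume "0 \<le> s" "s \<le> M"
  then have "cmod (poly (p m) (complex_of_real s) - f s) \<le> 1 / Suc m"
    "cmod (poly (p n) (complex_of_real s) - f s) \<le> 1 / Suc n" using p by auto
  then show "cmod (poly (p m - p n) (complex_of_real s)) \<le> 1 / Suc m + 1 / Suc n"
    unfolding poly_diff
    using norm_triangle_ineq4[of "poly (p m) (complex_of_real s) - f s" "poly (p n) (complex_of_real s) - f s"]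
    by simp
qed

lemma op_Cauchy_approximants: "op_Cauchy (\<lambda>n. opoly P (p n))"
  unfolding op_Cauchy_def
proof (intro conjI allI impI)
  obtain B where B: "B \<ge> 0" "\<And>x. normA A (opoly P (p 0) x) \<le> B * normA A x"
    using opoly_bounded by blast
  have "normA A (opoly P (p n) x) \<le> (2 + B) * normA A x" for n x
  proof -
    have "normA A (opoly P (p n) x) \<le> normA A (opoly P (p n) x - opoly P (p 0) x) + normA A (opoly P (p 0) x)"
      using normA_triangle[of "opoly P (p n) x - opoly P (p 0) x" "opoly P (p 0) x"] by simp
    also have "\<dots> \<le> (1 / Suc n + 1 / Suc 0) * normA A x + B * normA A x"
      by (intro add_mono approximants_close B)
    also have "\<dots> \<le> (1 + 1) * normA A x + B * normA A x"
      by (intro add_right_mono mult_right_mono add_mono) simp_all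
    finally show ?thesis by (simp add: algebra_simps)
  qed
  then show "\<exists>B\<ge>0. \<forall>n x. normA A (opoly P (p n) x) \<le> B * normA A x"
    using B(1) by (intro exI[of _ "2 + B"]) simp
next
  fix e :: real assume "e > 0"
  then obtain N where N: "1 / Suc N < e / 2" using nat_approx_posE[of "e / 2"] by auto
  have "normA A (opoly P (p m) x - opoly P (p n) x) \<le> e * normA A x" if "m \<ge> N" "n \<ge> N" for m n x
  proof -
    have "1 / Suc m \<le> 1 / Suc N" "1 / Suc n \<le> 1 / Suc N" using that by (simp_all add: frac_le)
    then have "(1 / Suc m + 1 / Suc n) * normA A x \<le> e * normA A x"
      using N by (intro mult_right_mono) (linarith, simp)
    with approximants_close[of m x n] show ?thesis by linarith
  qed
  then show "\<exists>N. \<forall>m\<ge>N. \<forall>n\<ge>N. \<forall>x. normA A (opoly P (p m) x - opoly P (p n) x) \<le> e * normA A x"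
    by blast
qed (simp_all add: opoly_vec_add opoly_vec_scale)

end

text \<open>Off \<open>[0, M]\<close> the inverse of \<open>S - t\<close> is built from polynomials approximating
  \<open>s \<mapsto> 1 / (s - t)\<close> on \<open>[0, M]\<close>.\<close>

lemma spectrum_subset:
  assumes "t \<in> spectrum K S"
  shows "\<exists>s\<in>{0..M}. t = complex_of_real s"
proof (rule ccontr)
  assume t: "\<not> ?thesis"
  define f where "f s = 1 / (complex_of_real s - t)" for s
  have "continuous_on {0..M} f"
    unfolding f_def using t by (intro continuous_intros) auto
  then obtain p where p: "\<forall>n. \<forall>s\<in>{0..M}. cmod (poly (p n) (complex_of_real s) - f s) \<le> 1 / Suc n"
    using complex_polynomial_sequence by blast
  note Cp = op_Cauchy_approximants[OF p]
  define C where "C = M + cmod t"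
  have id: "normA A (opoly P ([:-t, 1:] * p n) x - x) \<le> C / Suc n * normA A x" for n x
  proof -
    have "opoly P ([:-t, 1:] * p n) x - x = opoly P ([:-t, 1:] * p n - 1) x"
      by (simp only: opoly_diff opoly_one)
    also have "normA A \<dots> \<le> C / Suc n * normA A x"
    proof (rule normA_opoly_le_interval)
      fix s assume s: "0 \<le> s" "s \<le> M"
      then have st: "complex_of_real s - t \<noteq> 0" using t by auto
      have "poly ([:-t, 1:] * p n - 1) (complex_of_real s)
          = (complex_of_real s - t) * (poly (p n) (complex_of_real s) - f s)"
        using st by (simp add: f_def algebra_simps diff_divide_distrib[symmetric])
      also have "cmod \<dots> \<le> C * (1 / Suc n)"
        unfolding norm_mult
      proof (rule mult_mono)
        show "cmod (complex_of_real s - t) \<le> C"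
          using norm_triangle_ineq4[of "complex_of_real s" t] s by (simp add: C_def)
        show "cmod (poly (p n) (complex_of_real s) - f s) \<le> 1 / Suc n" using p s by simp
        show "0 \<le> C" using M_nonneg by (simp add: C_def)
      qed simp
      finally show "cmod (poly ([:-t, 1:] * p n - 1) (complex_of_real s)) \<le> C / Suc n" by simp
    qed
    finally show ?thesis .
  qed
  define R where "R = limit_op A (\<lambda>n. opoly P (p n))"
  have "R (op_diff K S (op_scale K t id) (cls X)) = cls X
      \<and> op_diff K S (op_scale K t id) (R (cls X)) = cls X" if X: "X \<in> CauchyA A" for X
  proof -
    have "(\<lambda>n. normA A (opoly P ([:-t, 1:] * p n) (X n) - X n)) \<longlonglongrightarrow> 0"
    proof (rule tendsto_0_le)
      have "(\<lambda>n. C * (1 / Suc n) * normA A (X n)) \<longlonglongrightarrow> C * 0 * nrm K (cls X)"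
        by (intro tendsto_intros LIMSEQ_Suc[OF lim_1_over_n] nrm_cls X)
      then show "(\<lambda>n. C / Suc n * normA A (X n)) \<longlonglongrightarrow> 0" by simp
    qed (use id in simp_all)
    then have lim: "cls (\<lambda>n. opoly P ([:-t, 1:] * p n) (X n)) = cls X"
      if "(\<lambda>n. opoly P ([:-t, 1:] * p n) (X n)) \<in> CauchyA A"
      using cls_eq_iff[OF that X] by simp
    have c1: "opoly P (p n) (P (X n) - t *\<^sub>C X n) = opoly P ([:-t, 1:] * p n) (X n)" for n
      unfolding mult.commute[of "[:-t, 1:]"] opoly_mult opoly_linear by (simp add: scaleC_minus_left)
    have c2: "P (opoly P (p n) (X n)) - t *\<^sub>C opoly P (p n) (X n) = opoly P ([:-t, 1:] * p n) (X n)" for n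
      unfolding opoly_mult opoly_linear by (simp add: scaleC_minus_left)
    have Y: "(\<lambda>n. opoly P (p n) (X n)) \<in> CauchyA A" by (rule CauchyA_op[OF Cp X])
    have Z: "(\<lambda>n. opoly P ([:-t, 1:] * p n) (X n)) \<in> CauchyA A"
      using shift_cls(2)[OF Y, of t] unfolding c2 .
    have "R (op_diff K S (op_scale K t id) (cls X)) = cls (\<lambda>n. opoly P ([:-t, 1:] * p n) (X n))"
      unfolding R_def shift_cls(1)[OF X] limit_op_cls[OF Cp shift_cls(2)[OF X]] c1 ..
    moreover have "op_diff K S (op_scale K t id) (R (cls X)) = cls (\<lambda>n. opoly P ([:-t, 1:] * p n) (X n))"
      unfolding R_def limit_op_cls[OF Cp X] shift_cls(1)[OF Y] c2 ..
    ultimately show ?thesis using lim[OF Z] by simp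
  qed
  then have "t \<notin> spectrum K S"
    unfolding spectrum_def R_def using limit_op_bounded[OF Cp] by (fastforce simp: pts_eq)
  with assms show False by blast
qed

text \<open>The operator of the functional calculus exists: the limit \<open>Q\<close> of one approximating sequence
  is the limit of every other one, because the norm of a polynomial of \<open>S\<close> is controlled by the
  values of the polynomial on the spectrum alone.\<close>

lemma cfc_properties:
  assumes f: "continuous_on {0..M} (\<lambda>s. f (complex_of_real s))"
  shows "cfc K f S \<in> bounded_ops K"
    and "uniform_limit (spectrum K S) (\<lambda>n. poly (q n)) f sequentially \<Longrightarrow>
      (\<lambda>n. op_norm K (op_diff K (poly_op K (q n) S) (cfc K f S))) \<longlonglongrightarrow> 0"
proof -
  obtain p where p: "\<forall>n. \<forall>s\<in>{0..M}. cmod (poly (p n) (complex_of_real s) - f (complex_of_real s)) \<le> 1 / Suc n"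
    using complex_polynomial_sequence[OF f] by blast
  note Cp = op_Cauchy_approximants[OF p]
  define Q where "Q = limit_op A (\<lambda>n. opoly P (p n))"
  have Q: "Q \<in> bounded_ops K" unfolding Q_def by (rule limit_op_bounded[OF Cp])
  have conv: "(\<lambda>n. op_norm K (op_diff K (poly_op K (q n) S) Q)) \<longlonglongrightarrow> 0"
    if q: "uniform_limit (spectrum K S) (\<lambda>n. poly (q n)) f sequentially" for q
  proof (rule LIMSEQ_I)
    fix e :: real assume e: "e > 0"
    then have "eventually (\<lambda>n. \<forall>t\<in>spectrum K S. dist (poly (q n) t) (f t) < e / 4) sequentially"
      using uniform_limitD[OF q, of "e / 4"] by simp
    then obtain N where N: "\<And>n t. n \<ge> N \<Longrightarrow> t \<in> spectrum K S \<Longrightarrow> cmod (poly (q n) t - f t) < e / 4"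
      by (auto simp: eventually_sequentially dist_norm)
    obtain k0 where k0: "1 / Suc k0 < e / 4" using nat_approx_posE[of "e / 4"] e by auto
    have small: "normA A (opoly P (q n) x - opoly P (p k) x) \<le> e / 2 * normA A x"
      if n: "n \<ge> N" and k: "k \<ge> k0" for n k x
      unfolding opoly_diff[symmetric]
    proof (rule normA_opoly_le)
      fix t assume t: "\<not> bounded_below_at t"
      then obtain s where s: "0 \<le> s" "s \<le> M" "t = complex_of_real s"
        by (rule not_bounded_below_at_imp)
      have "cmod (poly (q n) t - f t) < e / 4"
        using N[OF n in_spectrum_if_not_bounded_below[OF t]] .
      moreover have "cmod (poly (p k) t - f t) \<le> 1 / Suc k" using p s by simp
      moreover have "1 / Suc k \<le> 1 / Suc k0" using k by (simp add: frac_le)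
      ultimately have "cmod (poly (q n) t - f t) + cmod (poly (p k) t - f t) \<le> e / 2"
        using k0 by linarith
      then show "cmod (poly (q n - p k) t) \<le> e / 2"
        unfolding poly_diff using norm_triangle_ineq4[of "poly (q n) t - f t" "poly (p k) t - f t"]
        by simp
    qed
    have diff: "op_diff K (poly_op K (q n) S) Q (cls X)
        = cls (\<lambda>k. opoly P (q n) (X k) - opoly P (p k) (X k))" if X: "X \<in> CauchyA A" for X n
      unfolding Q_def
      by (rule op_diff_cls)
        (rule poly_op_cls[OF X] limit_op_cls[OF Cp X] CauchyA_opoly[OF X] CauchyA_op[OF Cp X])+
    have le: "nrm K (op_diff K (poly_op K (q n) S) Q (cls X)) \<le> e / 2 * nrm K (cls X)"
      if X: "X \<in> CauchyA A" and n: "n \<ge> N" for X n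
      unfolding diff[OF X]
      by (rule nrm_cls_le[OF CauchyA_diff[OF CauchyA_opoly[OF X] CauchyA_op[OF Cp X]] X])
        (rule small[OF n])
    have "norm (op_norm K (op_diff K (poly_op K (q n) S) Q) - 0) < e" if n: "n \<ge> N" for n
    proof -
      have "op_norm K (op_diff K (poly_op K (q n) S) Q) \<le> e / 2"
      proof (rule op_norm_leI)
        fix X assume "X \<in> CauchyA A" "nrm K (cls X) = 1"
        then show "nrm K (op_diff K (poly_op K (q n) S) Q (cls X)) \<le> e / 2"
          using le[OF _ n, of X] by simp
      qed (use e in simp)
      moreover have "op_norm K (op_diff K (poly_op K (q n) S) Q) \<ge> 0"
      proof (rule op_norm_nonneg)
        fix v assume "v \<in> pts K"
        then obtain X where "X \<in> CauchyA A" "v = cls X" by (auto simp: pts_eq)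
        then show "nrm K (op_diff K (poly_op K (q n) S) Q v) \<le> e / 2 * nrm K v"
          using le[OF _ n, of X] by simp
      qed
      ultimately show ?thesis using e by simp
    qed
    then show "\<exists>N. \<forall>n\<ge>N. norm (op_norm K (op_diff K (poly_op K (q n) S) Q) - 0) < e" by blast
  qed
  have "cfc K f S \<in> bounded_ops K \<and>
     (\<forall>p. uniform_limit (spectrum K S) (\<lambda>n. poly (p n)) f sequentially \<longrightarrow>
        (\<lambda>n. op_norm K (op_diff K (poly_op K (p n) S) (cfc K f S))) \<longlonglongrightarrow> 0)"
    unfolding cfc_def by (rule someI[of _ Q]) (use Q conv in blast)
  then show "cfc K f S \<in> bounded_ops K"
    and "uniform_limit (spectrum K S) (\<lambda>n. poly (q n)) f sequentially \<Longrightarrow>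
      (\<lambda>n. op_norm K (op_diff K (poly_op K (q n) S) (cfc K f S))) \<longlonglongrightarrow> 0"
    by blast+
qed

lemma continuous_on_power: "r \<ge> 1 \<Longrightarrow> continuous_on {0..M} (\<lambda>s. complex_of_real (Re (complex_of_real s) powr r))"
  by (intro continuous_on_of_real, simp) (intro continuous_on_powr' continuous_intros; simp)

lemma pos_power_bounded: "r \<ge> 1 \<Longrightarrow> pos_power K S r \<in> bounded_ops K"
  unfolding pos_power_def by (rule cfc_properties(1)[OF continuous_on_power])

text \<open>McCarthy's inequality \<open>\<langle>P x, x\<rangle>\<^sup>r \<le> \<langle>P\<^sup>r x, x\<rangle>\<close> for the functional calculus, read off a
  representative \<open>Z\<close> of the vector \<open>P\<^sup>r x\<close> of the completion.\<close>

lemma McCarthy_pos_power: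
  assumes r: "r \<ge> 1" and x: "normA A x = 1"
  shows "\<exists>Z\<in>CauchyA A. pos_power K S r (cls (\<lambda>_. x)) = cls Z \<and>
    (\<forall>e>0. \<exists>N. \<forall>k\<ge>N. Re (cinnerA A (P x) x) powr r - e \<le> Re (cinnerA A (Z k) x))"
proof -
  define Q where "Q = pos_power K S r"
  define f where "f z = complex_of_real (Re z powr r)" for z
  have Q_cfc: "Q = cfc K f S" by (simp add: Q_def pos_power_def f_def[abs_def])
  have f: "continuous_on {0..M} (\<lambda>s. f (complex_of_real s))"
    unfolding f_def by (rule continuous_on_power[OF r])
  have Qb: "Q \<in> bounded_ops K" unfolding Q_def by (rule pos_power_bounded[OF r])
  let ?u = "cls (\<lambda>_. x)"
  have u: "?u \<in> pts K" "nrm K ?u = 1" using x by (simp_all add: cls_in_pts CauchyA_const nrm_cls_const)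
  have "Q ?u \<in> pts K" using Qb u unfolding bounded_ops_def by blast
  then obtain Z where Z: "Z \<in> CauchyA A" "Q ?u = cls Z" by (auto simp: pts_eq)
  obtain p where p: "\<forall>n. \<forall>s\<in>{0..M}. cmod (poly (p n) (complex_of_real s) - f (complex_of_real s)) \<le> 1 / Suc n"
    using complex_polynomial_sequence[OF f] by blast
  have "uniform_limit (spectrum K S) (\<lambda>n. poly (p n)) f sequentially"
  proof (rule uniform_limitI)
    fix e :: real assume "e > 0"
    then obtain N where N: "1 / Suc N < e" using nat_approx_posE[of e] by auto
    have "dist (poly (p n) t) (f t) < e" if n: "n \<ge> N" and t: "t \<in> spectrum K S" for n t
    proof -
      obtain s where "s \<in> {0..M}" "t = complex_of_real s" using spectrum_subset[OF t] by blast
      then have "dist (poly (p n) t) (f t) \<le> 1 / Suc n" using p by (simp add: dist_norm)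
      also have "\<dots> \<le> 1 / Suc N" using n by (simp add: frac_le)
      finally show ?thesis using N by linarith
    qed
    then show "\<forall>\<^sub>F n in sequentially. \<forall>t\<in>spectrum K S. dist (poly (p n) t) (f t) < e"
      unfolding eventually_sequentially by blast
  qed
  then have lim: "(\<lambda>n. op_norm K (op_diff K (poly_op K (p n) S) Q)) \<longlonglongrightarrow> 0"
    unfolding Q_cfc by (rule cfc_properties(2)[OF f])
  obtain b where b: "\<And>v. v \<in> pts K \<Longrightarrow> nrm K (Q v) \<le> b * nrm K v"
    using bounded_ops_bound[OF Qb] by blast
  have "\<exists>N. \<forall>k\<ge>N. Re (cinnerA A (P x) x) powr r - e \<le> Re (cinnerA A (Z k) x)" if e: "e > 0" for e
  proof -
    obtain n1 where n1: "\<And>n. n \<ge> n1 \<Longrightarrow> op_norm K (op_diff K (poly_op K (p n) S) Q) < e / 2"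
      using order_tendstoD(2)[OF lim, of "e / 2"] e by (auto simp: eventually_sequentially)
    obtain n2 where n2: "1 / Suc n2 < e / 2" using nat_approx_posE[of "e / 2"] e by auto
    define n where "n = max n1 n2"
    have "1 / Suc n \<le> 1 / Suc n2" by (simp add: n_def frac_le)
    with n2 have n: "1 / Suc n < e / 2" by linarith
    obtain B where B: "\<And>y. normA A (opoly P (p n) y) \<le> B * normA A y" using opoly_bounded by blast
    have "nrm K (op_diff K (poly_op K (p n) S) Q ?u) \<le> op_norm K (op_diff K (poly_op K (p n) S) Q)"
    proof (rule le_op_norm[OF u])
      fix v assume v: "v \<in> pts K"
      then obtain X where X: "X \<in> CauchyA A" "v = cls X" by (auto simp: pts_eq)
      show "nrm K (op_diff K (poly_op K (p n) S) Q v) \<le> (B + b) * nrm K v"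
      proof (rule nrm_op_diff_le[OF v])
        show "poly_op K (p n) S v \<in> pts K" using X by (simp add: poly_op_cls CauchyA_opoly cls_in_pts)
        show "Q v \<in> pts K" using Qb v unfolding bounded_ops_def by blast
        show "nrm K (Q v) \<le> b * nrm K v" by (rule b[OF v])
        show "nrm K (poly_op K (p n) S v) \<le> B * nrm K v"
          unfolding X(2) poly_op_cls[OF X(1)] by (rule nrm_cls_le[OF CauchyA_opoly[OF X(1)] X(1) B])
      qed
    qed
    also have "\<dots> < e / 2" by (rule n1) (simp add: n_def)
    also have "op_diff K (poly_op K (p n) S) Q ?u = cls (\<lambda>k. opoly P (p n) x - Z k)"
      by (rule op_diff_cls) (rule poly_op_cls[OF CauchyA_const] Z CauchyA_const)+
    finally have "nrm K (cls (\<lambda>k. opoly P (p n) x - Z k)) < e / 2" .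
    from order_tendstoD(2)[OF nrm_cls[OF CauchyA_diff[OF CauchyA_const Z(1)]] this]
    obtain N where N: "\<And>k. k \<ge> N \<Longrightarrow> normA A (opoly P (p n) x - Z k) < e / 2"
      by (auto simp: eventually_sequentially)
    have "Re (cinnerA A (P x) x) powr r - 1 / Suc n \<le> Re (cinnerA A (opoly P (p n) x) x)"
      by (rule McCarthy_approximation[OF r x]) (use p in \<open>simp add: f_def\<close>)
    moreover have "Re (cinnerA A (opoly P (p n) x) x) - Re (cinnerA A (Z k) x)
        \<le> normA A (opoly P (p n) x - Z k)" for k
      using Re_cinnerA_le[of "opoly P (p n) x - Z k" x] x by (simp add: cinnerA_simps)
    ultimately have "Re (cinnerA A (P x) x) powr r - e \<le> Re (cinnerA A (Z k) x)" if "k \<ge> N" for k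
      using N[OF that] n by (smt (verit) field_sum_of_halves)
    then show ?thesis by blast
  qed
  with Z show ?thesis unfolding Q_def by blast
qed

end


section \<open>The numerical radius inequality\<close>

context positive_operator
begin

text \<open>For an exponent in \<open>\<nat>\<close> the powers are polynomials on the original space; for the others
  McCarthy's inequality holds for approximating representatives of \<open>P\<^sup>r x\<close> and \<open>Q\<^sup>r x\<close>.  In both
  cases \<open>\<langle>(P\<^sup>r + Q\<^sup>r) x, x\<rangle> \<le> \<parallel>P\<^sup>r + Q\<^sup>r\<parallel>\<close> for unit vectors \<open>x\<close>.\<close>

lemma McCarthy_power_sum:
  assumes P: "positive_bounded_A A P M1" and Q: "positive_bounded_A A Q M2"
    and r: "r \<ge> 1" and x: "normA A x = 1"
  shows "Re (cinnerA A (P x) x) powr r + Re (cinnerA A (Q x) x) powr r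
    \<le> power_sum_seminormA A P Q r"
proof -
  interpret P: positive_bounded_A A P M1 by fact
  interpret Q: positive_bounded_A A Q M2 by fact
  show ?thesis
  proof (cases "r \<in> \<nat>")
    case True
    then obtain n where n: "r = real n" by (auto simp: Nats_def)
    then have n1: "n \<ge> 1" using r by simp
    define F where "F y = (P ^^ n) y + (Q ^^ n) y" for y
    have powr_n: "t powr real n = t ^ n" if "t \<ge> 0" for t :: real
      using that n1 by (cases "t = 0") (auto simp: powr_realpow)
    obtain B1 where B1: "\<And>y. normA A ((P ^^ n) y) \<le> B1 * normA A y"
      using P.opoly_bounded[of "monom 1 n"] unfolding P.opoly_monom by blast
    obtain B2 where B2: "\<And>y. normA A ((Q ^^ n) y) \<le> B2 * normA A y"
      using Q.opoly_bounded[of "monom 1 n"] unfolding Q.opoly_monom by blast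
    have F_le: "normA A (F y) \<le> B1 + B2" if "normA A y = 1" for y
      using normA_triangle[of "(P ^^ n) y" "(Q ^^ n) y"] B1[of y] B2[of y] that
      by (simp add: F_def)
    have bdd: "bdd_above (insert 0 {normA A (F y) | y. normA A y = 1})"
      using F_le by (intro bdd_aboveI[of _ "max 0 (B1 + B2)"]) fastforce
    have "Re (cinnerA A (P x) x) ^ n + Re (cinnerA A (Q x) x) ^ n \<le> Re (cinnerA A (F x) x)"
      using P.McCarthy_integer[OF n1 x] Q.McCarthy_integer[OF n1 x]
      by (simp add: F_def cinnerA_simps)
    also have "\<dots> \<le> normA A (F x)" using Re_cinnerA_le[of "F x" x] x by simp
    also have "\<dots> \<le> onormA A F" unfolding onormA_def using bdd x by (intro cSup_upper) auto
    finally show ?thesis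
      by (simp add: power_sum_seminormA_def n F_def[abs_def] powr_n P.P_nonneg Q.P_nonneg)
  next
    case False
    define P' where "P' = pos_power K (induced_op A P) r"
    define Q' where "Q' = pos_power K (induced_op A Q) r"
    have P': "P' \<in> bounded_ops K" unfolding P'_def by (rule P.pos_power_bounded[OF r])
    have Q': "Q' \<in> bounded_ops K" unfolding Q'_def by (rule Q.pos_power_bounded[OF r])
    obtain b1 where b1: "\<And>v. v \<in> pts K \<Longrightarrow> nrm K (P' v) \<le> b1 * nrm K v"
      using bounded_ops_bound[OF P'] by blast
    obtain b2 where b2: "\<And>v. v \<in> pts K \<Longrightarrow> nrm K (Q' v) \<le> b2 * nrm K v"
      using bounded_ops_bound[OF Q'] by blast
    let ?u = "cls (\<lambda>_. x)"
    have u: "?u \<in> pts K" "nrm K ?u = 1"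
      using x by (simp_all add: cls_in_pts CauchyA_const nrm_cls_const)
    obtain Y where Y: "Y \<in> CauchyA A" "P' ?u = cls Y"
      "\<And>e. e > 0 \<Longrightarrow> \<exists>N. \<forall>k\<ge>N. Re (cinnerA A (P x) x) powr r - e \<le> Re (cinnerA A (Y k) x)"
      using P.McCarthy_pos_power[OF r x] unfolding P'_def by blast
    obtain Z where Z: "Z \<in> CauchyA A" "Q' ?u = cls Z"
      "\<And>e. e > 0 \<Longrightarrow> \<exists>N. \<forall>k\<ge>N. Re (cinnerA A (Q x) x) powr r - e \<le> Re (cinnerA A (Z k) x)"
      using Q.McCarthy_pos_power[OF r x] unfolding Q'_def by blast
    have sum: "op_add K P' Q' ?u = cls (\<lambda>k. Y k + Z k)"
      using Y Z by (simp add: op_add_def add_cls)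
    have "Re (cinnerA A (P x) x) powr r + Re (cinnerA A (Q x) x) powr r \<le> nrm K (op_add K P' Q' ?u)"
    proof (rule field_le_epsilon)
      fix e :: real assume "e > 0"
      then have e2: "e / 2 > 0" by simp
      obtain N1 where N1: "\<And>k. k \<ge> N1 \<Longrightarrow>
          Re (cinnerA A (P x) x) powr r - e / 2 \<le> Re (cinnerA A (Y k) x)"
        using Y(3)[OF e2] by blast
      obtain N2 where N2: "\<And>k. k \<ge> N2 \<Longrightarrow>
          Re (cinnerA A (Q x) x) powr r - e / 2 \<le> Re (cinnerA A (Z k) x)"
        using Z(3)[OF e2] by blast
      have "Re (cinnerA A (P x) x) powr r + Re (cinnerA A (Q x) x) powr r - e \<le> normA A (Y k + Z k)"
        if "k \<ge> max N1 N2" for k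
        using N1[of k] N2[of k] that Re_cinnerA_le[of "Y k + Z k" x] x
        by (simp add: cinnerA_simps field_simps)
      then have "Re (cinnerA A (P x) x) powr r + Re (cinnerA A (Q x) x) powr r - e
          \<le> nrm K (cls (\<lambda>k. Y k + Z k))"
        by (intro LIMSEQ_le_const[OF nrm_cls[OF CauchyA_add[OF Y(1) Z(1)]]]) blast
      then show "Re (cinnerA A (P x) x) powr r + Re (cinnerA A (Q x) x) powr r
          \<le> nrm K (op_add K P' Q' ?u) + e"
        unfolding sum by simp
    qed
    also have "\<dots> \<le> op_norm K (op_add K P' Q')"
    proof (rule le_op_norm[OF u])
      fix v assume v: "v \<in> pts K"
      show "nrm K (op_add K P' Q' v) \<le> (b1 + b2) * nrm K v"
        using v bounded_ops_pts[OF P' v] bounded_ops_pts[OF Q' v] b1[OF v] b2[OF v]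
        by (rule nrm_op_add_le)
    qed
    finally show ?thesis using False by (simp add: power_sum_seminormA_def P'_def Q'_def)
  qed
qed

text \<open>The reflection \<open>d = 2 \<langle>a, e\<rangle> e - a\<close> of \<open>a\<close> has the seminorm of \<open>a\<close>, and
  \<open>2 \<langle>a, e\<rangle> \<langle>e, b\<rangle> = \<langle>d, b\<rangle> + \<langle>a, b\<rangle>\<close>.\<close>

lemma Buzano_A:
  assumes e: "normA A e = 1"
  shows "cmod (cinnerA A a e * cinnerA A e b) \<le> (normA A a * normA A b + cmod (cinnerA A a b)) / 2"
proof -
  define c where "c = cinnerA A a e"
  define d where "d = (2 * c) *\<^sub>C e - a"
  have ea: "cinnerA A e a = cnj c" using cinnerA_commute[of e a] by (simp add: c_def)
  have "cinnerA A d d = cinnerA A a a"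
    by (simp add: d_def cinnerA_simps ea c_def[symmetric] cinnerA_self[of e] e algebra_simps)
  then have d: "normA A d = normA A a" by (simp add: normA_def)
  have "2 * (c * cinnerA A e b) = cinnerA A d b + cinnerA A a b"
    by (simp add: d_def cinnerA_simps)
  then have "cmod (2 * (c * cinnerA A e b)) \<le> cmod (cinnerA A d b) + cmod (cinnerA A a b)"
    by (simp only: norm_triangle_ineq)
  then have "2 * cmod (c * cinnerA A e b) \<le> cmod (cinnerA A d b) + cmod (cinnerA A a b)"
    by (simp only: norm_mult[of 2] norm_numeral)
  then show ?thesis using Cauchy_Schwarz_A[of d b] d by (simp add: c_def)
qed

lemma le_num_radiusA:
  assumes F: "bounded_A F" and x: "normA A x = 1"
  shows "cmod (cinnerA A (F x) x) \<le> num_radiusA A F"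
proof -
  obtain B where B: "B \<ge> 0" "\<And>y. normA A (F y) \<le> B * normA A y" using F by (auto simp: bounded_A_def)
  have "cmod (cinnerA A (F y) y) \<le> B" if "normA A y = 1" for y
    using Cauchy_Schwarz_A[of "F y" y] B(2)[of y] that by simp
  then have "bdd_above (insert 0 {cmod (cinnerA A (F y) y) | y. normA A y = 1})"
    using B(1) by (intro bdd_aboveI[of _ B]) auto
  then show ?thesis unfolding num_radiusA_def using x by (intro cSup_upper) auto
qed

lemma num_radiusA_powr_le:
  assumes s: "s > 0" and c: "c \<ge> 0"
    and le: "\<And>x. normA A x = 1 \<Longrightarrow> cmod (cinnerA A (F x) x) powr s \<le> c"
  shows "num_radiusA A F powr s \<le> c"
proof -
  have "cmod (cinnerA A (F x) x) \<le> c powr (1 / s)" if "normA A x = 1" for x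
  proof -
    have "(cmod (cinnerA A (F x) x) powr s) powr (1 / s) \<le> c powr (1 / s)"
      using s le[OF that] by (intro powr_mono2) auto
    then show ?thesis using s by (simp add: powr_powr)
  qed
  then have le': "num_radiusA A F \<le> c powr (1 / s)"
    unfolding num_radiusA_def by (intro cSup_least) auto
  show ?thesis
  proof (cases "num_radiusA A F \<ge> 0")
    case True
    then have "num_radiusA A F powr s \<le> (c powr (1 / s)) powr s"
      using le' s by (intro powr_mono2) auto
    then show ?thesis using s c by (simp add: powr_powr)
  next
    case False
    have "bdd_above (insert 0 {cmod (cinnerA A (F x) x) | x. normA A x = 1})"
      using \<open>\<And>x. normA A x = 1 \<Longrightarrow> cmod (cinnerA A (F x) x) \<le> c powr (1 / s)\<close>
      by (intro bdd_aboveI[of _ "c powr (1 / s)"]) auto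
    then have "num_radiusA A F \<ge> 0" unfolding num_radiusA_def by (intro cSup_upper) auto
    with False show ?thesis by simp
  qed
qed

end

lemma power2_powr: "u \<ge> 0 \<Longrightarrow> (u\<^sup>2) powr s = u powr (2 * s)" for u :: real
  by (cases "u = 0") (simp_all add: powr_powr flip: powr_numeral)

lemma powr_midpoint_le:
  fixes a b s :: real
  assumes "s \<ge> 1" "a \<ge> 0" "b \<ge> 0"
  shows "((a + b) / 2) powr s \<le> (a powr s + b powr s) / 2"
proof -
  obtain k l where "\<And>t. t \<ge> 0 \<Longrightarrow> k * t + l \<le> t powr s"
    "k * ((a + b) / 2) + l = ((a + b) / 2) powr s"
    using powr_supporting_line[of s "(a + b) / 2"] assms by auto
  from this(1)[of a] this(1)[of b] this(2) assms show ?thesis by (simp add: field_simps)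
qed

context positive_operator
begin

lemma sharpA_comp_positive_bounded:
  assumes T: "T \<in> BA A"
  shows "\<exists>M. positive_bounded_A A (sharpA A T \<circ> T) M" "\<exists>M. positive_bounded_A A (T \<circ> sharpA A T) M"
proof -
  obtain B where B: "B \<ge> 0" "\<And>x. normA A (T x) \<le> B * normA A x"
    using bounded_A_T[OF T] by (auto simp: bounded_A_def)
  obtain C where C: "C \<ge> 0" "\<And>x. normA A (sharpA A T x) \<le> C * normA A x"
    using bounded_A_sharpA[OF T] by (auto simp: bounded_A_def)
  note T_simps = op_additive_simps[OF clinear_T[OF T]]
  have 1: "normA A (sharpA A T (T x)) \<le> C * B * normA A x" for x
    using C(2)[of "T x"] mult_left_mono[OF B(2)[of x] C(1)] by (simp add: mult.assoc)
  have 2: "normA A (T (sharpA A T x)) \<le> C * B * normA A x" for x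
    using B(2)[of "sharpA A T x"] mult_left_mono[OF C(2)[of x] B(1)] by (simp add: mult_ac)
  show "\<exists>M. positive_bounded_A A (sharpA A T \<circ> T) M"
    by (rule exI[of _ "C * B"], unfold_locales)
      (use B C 1 in \<open>auto simp: T_simps sharpA_add[OF T] sharpA_scale[OF T] cinnerA_sharpA_left[OF T]
         cinnerA_self_nonneg simp flip: cinnerA_sharpA_right[OF T]\<close>)
  show "\<exists>M. positive_bounded_A A (T \<circ> sharpA A T) M"
    by (rule exI[of _ "C * B"], unfold_locales)
      (use B C 2 in \<open>auto simp: T_simps sharpA_add[OF T] sharpA_scale[OF T] cinnerA_sharpA_right[OF T]
         cinnerA_self_nonneg simp flip: cinnerA_sharpA_left[OF T]\<close>)
qed

end

theorem theorem3p4: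
  fixes A T :: "'h::chilbert_space \<Rightarrow> 'h" and \<alpha> \<beta> r \<delta>\<^sub>1 \<delta>\<^sub>2 :: real
  assumes nontrivial: "\<exists>x::'h. x \<noteq> 0"
    and A: "positive_op A"
    and T: "T \<in> BA A"
    and \<alpha>: "\<alpha> \<in> {0..1}"
    and r: "r \<ge> 1"
    and \<beta>: "\<beta> \<ge> 0"
    and \<delta>\<^sub>1: "\<delta>\<^sub>1 = (1 + \<alpha> + 2 * \<beta>) / (2 * (1 + \<beta>))"
    and \<delta>\<^sub>2: "\<delta>\<^sub>2 = (1 - \<alpha>) / (2 * (1 + \<beta>))"
  shows "num_radiusA A T powr (4 * r)
    \<le> \<delta>\<^sub>1 / 4 * (power_sum_seminormA A (sharpA A T \<circ> T) (T \<circ> sharpA A T) r)\<^sup>2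
      + \<delta>\<^sub>2 * num_radiusA A (T \<circ> T) powr (2 * r)"
proof -
  interpret positive_operator A by unfold_locales (rule A)
  obtain M1 where P: "positive_bounded_A A (sharpA A T \<circ> T) M1"
    using sharpA_comp_positive_bounded(1)[OF T] by blast
  obtain M2 where Q: "positive_bounded_A A (T \<circ> sharpA A T) M2"
    using sharpA_comp_positive_bounded(2)[OF T] by blast
  define \<Sigma> where "\<Sigma> = power_sum_seminormA A (sharpA A T \<circ> T) (T \<circ> sharpA A T) r"
  define W where "W = num_radiusA A (T \<circ> T)"
  have \<delta>_sum: "\<delta>\<^sub>1 + \<delta>\<^sub>2 = 1" and \<delta>_ge: "\<delta>\<^sub>1 \<ge> 1 / 2" "\<delta>\<^sub>2 \<ge> 0"
  proof -
    have pos: "2 * (1 + \<beta>) > 0" using \<beta> by simp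
    have "\<delta>\<^sub>1 + \<delta>\<^sub>2 = (2 * (1 + \<beta>)) / (2 * (1 + \<beta>))"
      unfolding \<delta>\<^sub>1 \<delta>\<^sub>2 add_divide_distrib[symmetric] by (simp add: algebra_simps)
    then show "\<delta>\<^sub>1 + \<delta>\<^sub>2 = 1" using pos by simp
    show "\<delta>\<^sub>1 \<ge> 1 / 2" "\<delta>\<^sub>2 \<ge> 0"
      using \<alpha> \<beta> pos unfolding \<delta>\<^sub>1 \<delta>\<^sub>2 by (simp_all add: pos_le_divide_eq)
  qed
  have TT: "bounded_A (T \<circ> T)"
  proof -
    obtain B where B: "B \<ge> 0" "\<And>x. normA A (T x) \<le> B * normA A x"
      using bounded_A_T[OF T] by (auto simp: bounded_A_def)
    have "normA A (T (T x)) \<le> (B * B) * normA A x" for x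
      using B(2)[of "T x"] mult_left_mono[OF B(2)[of x] B(1)] by (simp add: mult.assoc)
    then show ?thesis unfolding bounded_A_def using B(1) by (intro exI[of _ "B * B"]) simp
  qed
  have "cmod (cinnerA A (T x) x) powr (4 * r) \<le> \<delta>\<^sub>1 / 4 * \<Sigma>\<^sup>2 + \<delta>\<^sub>2 * W powr (2 * r)"
    if x: "normA A x = 1" for x
  proof -
    define u where "u = cmod (cinnerA A (T x) x)"
    define p where "p = (normA A (T x))\<^sup>2"
    define q where "q = (normA A (sharpA A T x))\<^sup>2"
    define N where "N = normA A (T x) * normA A (sharpA A T x)"
    define m where "m = cmod (cinnerA A (T (T x)) x)"
    have N0: "N \<ge> 0" and m0: "m \<ge> 0" by (simp_all add: N_def m_def)
    have m_eq: "m = cmod (cinnerA A (T x) (sharpA A T x))"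
      by (simp add: m_def cinnerA_sharpA_right[OF T])
    \<comment> \<open>Buzano's inequality for \<open>a = T x\<close>, \<open>b = T\<^sup>\<sharp> x\<close> and \<open>e = x\<close>\<close>
    have "u\<^sup>2 = cmod (cinnerA A (T x) x * cinnerA A x (sharpA A T x))"
      by (simp add: u_def norm_mult power2_eq_square flip: cinnerA_sharpA_right[OF T])
    also have "\<dots> \<le> (N + m) / 2" unfolding N_def m_eq by (rule Buzano_A[OF x])
    finally have u: "u\<^sup>2 \<le> (N + m) / 2" .
    have "u powr (4 * r) = (u\<^sup>2) powr (2 * r)" by (simp add: power2_powr u_def)
    also have "\<dots> \<le> ((N + m) / 2) powr (2 * r)" using u r by (intro powr_mono2) auto
    also have "\<dots> \<le> (N powr (2 * r) + m powr (2 * r)) / 2"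
      using r N0 m0 by (intro powr_midpoint_le) auto
    \<comment> \<open>as \<open>m \<le> N\<close>, weight may be moved from \<open>m\<close> to \<open>N\<close>: \<open>\<delta>\<^sub>1 + \<delta>\<^sub>2 = 1\<close> and \<open>\<delta>\<^sub>1 \<ge> 1 / 2\<close>\<close>
    also have "\<dots> \<le> \<delta>\<^sub>1 * N powr (2 * r) + \<delta>\<^sub>2 * m powr (2 * r)"
    proof -
      have "m \<le> N" unfolding m_eq N_def by (rule Cauchy_Schwarz_A)
      then have "m powr (2 * r) \<le> N powr (2 * r)" using r m0 by (intro powr_mono2) auto
      then have "(\<delta>\<^sub>1 - 1 / 2) * m powr (2 * r) \<le> (\<delta>\<^sub>1 - 1 / 2) * N powr (2 * r)"
        using \<delta>_ge(1) by (intro mult_left_mono) auto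
      moreover have \<delta>\<^sub>2_eq: "\<delta>\<^sub>2 = 1 - \<delta>\<^sub>1" using \<delta>_sum by linarith
      ultimately show ?thesis unfolding \<delta>\<^sub>2_eq by (simp add: left_diff_distrib add_divide_distrib)
    qed
    also have "\<delta>\<^sub>1 * N powr (2 * r) \<le> \<delta>\<^sub>1 * (\<Sigma>\<^sup>2 / 4)"
    proof (rule mult_left_mono)
      have "N powr (2 * r) = (p * q) powr r"
        using N0 by (simp add: p_def q_def N_def power_mult_distrib flip: power2_powr)
      also have "\<dots> = p powr r * q powr r" by (simp add: p_def q_def powr_mult)
      also have "\<dots> \<le> (p powr r + q powr r)\<^sup>2 / 4"
        using sum_squares_bound[of "p powr r" "q powr r"] by (simp add: power2_sum)
      also have "\<dots> \<le> \<Sigma>\<^sup>2 / 4"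
      proof -
        have "p powr r + q powr r \<le> \<Sigma>"
          using McCarthy_power_sum[OF P Q r x]
          by (simp add: p_def q_def \<Sigma>_def normA_sq cinnerA_sharpA_left[OF T] cinnerA_sharpA_right[OF T])
        then have "(p powr r + q powr r)\<^sup>2 \<le> \<Sigma>\<^sup>2" by (intro power_mono) simp_all
        then show ?thesis by simp
      qed
      finally show "N powr (2 * r) \<le> \<Sigma>\<^sup>2 / 4" .
    qed (use \<delta>_ge in simp)
    also have "\<delta>\<^sub>2 * m powr (2 * r) \<le> \<delta>\<^sub>2 * W powr (2 * r)"
    proof -
      have "m \<le> W" unfolding m_def W_def using le_num_radiusA[OF TT x] by simp
      then show ?thesis using r m0 \<delta>_ge(2) by (intro mult_left_mono powr_mono2) auto
    qed
    finally show ?thesis by (simp add: u_def)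
  qed
  then show ?thesis
    unfolding \<Sigma>_def W_def using r \<delta>_ge by (intro num_radiusA_powr_le) auto
qed

end
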